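(* For every control strategy $\mathbf g\in\mathcal G$ derived for the CPS model, the information state $\Pi_t(\Delta_t,\Lambda_t^{1:K})(X_t,\hat X_t)$, i.e. the conditional joint density $p^{\mathbf g}(X_t,\hat X_t\mid \Delta_t,\Lambda_t^{1:K})$, does not depend on the control strategy $\mathbf g$. Moreover, for all $t=0,1,\ldots,T-1$ there is a function $\phi_t$, which does not depend on the control strategy $\mathbf g$, such that $$\Pi_{t+1}(\Delta_{t+1},\Lambda_{t+1}^{1:K})(X_{t+1},\hat X_{t+1})=\phi_t\big[\Pi_t(\Delta_t,\Lambda_t^{1:K})(X_t,\hat X_t),\,Y_{t+1}^{1:K},\,U_t^{1:K}\big].$$
   Context: Setting. Fix $K,T\in\mathbb N$, $\mathcal K=\{1,\dots,K\}$, a delay $n\in\mathbb N$, and a probability space $(\Omega,\mathscr F,\mathbb P)$. Superscripts index subsystems, subscripts index time; $A^{1:K}_t=(A^1_t,\dots,A^K_t)$ and $A_{s:t}=(A_s,\dots,A_t)$ (entries with negative time are absent). There are two systems with the same state spaces $(\mathcal X_t,\mathscr X_t)$, driven by the same control and the same disturbance: the "CPS model" with state $X_t$ and the "actual CPS" with state $\hat X_t$, $$X_{t+1}=f_t(X_t,U_t^{1:K},W_t),\qquad \hat X_{t+1}=\hat f_t(\hat X_t,U_t^{1:K},W_t),\qquad t=0,\dots,T-1,$$ with $U_t^k$ taking values in a measurable space $(\mathcal U_t^k,\mathscr U_t^k)$ and $W_t$ in $(\mathcal W,\mathscr W)$. Model observations are $Y_t^k=h_t^k(X_t,Z_t^k)$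 with values in $(\mathcal Y^k,\mathscr Y^k)$, where $Z_t^k$ takes values in $(\mathcal Z^k,\mathscr Z^k)$; the observation equation is used for all times $t=0,\dots,T$. The variables $W_t$ are independent of each other and of $(X_0,\hat X_0)$; the variables $Z_t^k$ are independent of each other, of all $W_t$, and of $(X_0,\hat X_0)$. Model data: $\Delta_t=(Y^{1:K}_{0:t-n},U^{1:K}_{0:t-n})$ (data shared by all subsystems) and $\Lambda_t^k=(Y^k_{t-n+1:t},U^k_{t-n+1:t-1})$ (data known only to subsystem $k$). A control strategy $\mathbf g=\{g_t;\,t=0,\dots,T-1\}\in\mathcal G$ is a sequence of measurable functions (control laws) giving $U_t^{1:K}=g_t(\Delta_t,\Lambda_t^{1:K})\in\prod_{k}\mathcal U_t^k$. All probability distributions are assumed to have densities, denoted $p(\cdot)$; a superscript $\mathbf g$ indicates that the density is the one induced by the strategy $\mathbf g$. The information state $\Pi_t(\Delta_t,\Lambda_t^{1:K})(X_t,\hat X_t)$ denotes the whole conditional density function $p(\cdot,\cdot\mid\Delta_t,\Lambda_t^{1:K})$ of $(X_t,\hat X_t)$ given the model data $(\Delta_t,\Lambda_t^{1:K})$, not merely its value at one point. "Does not depend on $\mathbf g$" means that, for a given realization of the data $(\Delta_t,\Lambda_t^{1:K})$, the conditional density is the same for all strategies. *)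

theory Defs
  imports "HOL-Probability.Probability"
begin

text \<open>
  Vectors over the subsystems are extensional functions on \<open>{1..K}\<close>; trajectories over a set of
  times are extensional functions on that set.  With delay \<open>n\<close>, the times \<open>0, \<dots>, t - n\<close> are written
  \<open>{s. s + n \<le> t}\<close> and the times \<open>s \<ge> t - n + 1\<close> are written \<open>t < s + n\<close>, so that no truncated
  subtraction occurs and negative times drop out.
\<close>

type_synonym ('y, 'u) common_data = "(nat \<Rightarrow> nat \<Rightarrow> 'y) \<times> (nat \<Rightarrow> nat \<Rightarrow> 'u)"
type_synonym ('y, 'u) local_data = "(nat \<Rightarrow> 'y) \<times> (nat \<Rightarrow> 'u)"
type_synonym ('y, 'u) data = "('y, 'u) common_data \<times> (nat \<Rightarrow> ('y, 'u) local_data)"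

definition shared_data ::
  "nat \<Rightarrow> (nat \<Rightarrow> 'o \<Rightarrow> nat \<Rightarrow> 'y) \<Rightarrow> (nat \<Rightarrow> 'o \<Rightarrow> nat \<Rightarrow> 'u) \<Rightarrow> nat \<Rightarrow> 'o \<Rightarrow> ('y, 'u) common_data"
  where "shared_data n Y U t \<omega> =
    ((\<lambda>s\<in>{s. s + n \<le> t}. Y s \<omega>), (\<lambda>s\<in>{s. s + n \<le> t}. U s \<omega>))"

definition private_data ::
  "nat \<Rightarrow> (nat \<Rightarrow> 'o \<Rightarrow> nat \<Rightarrow> 'y) \<Rightarrow> (nat \<Rightarrow> 'o \<Rightarrow> nat \<Rightarrow> 'u) \<Rightarrow> nat \<Rightarrow> nat \<Rightarrow> 'o \<Rightarrow> ('y, 'u) local_data"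
  where "private_data n Y U t k \<omega> =
    ((\<lambda>s\<in>{s. t < s + n \<and> s \<le> t}. Y s \<omega> k), (\<lambda>s\<in>{s. t < s + n \<and> s < t}. U s \<omega> k))"

definition model_data ::
  "nat \<Rightarrow> nat \<Rightarrow> (nat \<Rightarrow> 'o \<Rightarrow> nat \<Rightarrow> 'y) \<Rightarrow> (nat \<Rightarrow> 'o \<Rightarrow> nat \<Rightarrow> 'u) \<Rightarrow> nat \<Rightarrow> 'o \<Rightarrow> ('y, 'u) data"
  where "model_data K n Y U t \<omega> =
    (shared_data n Y U t \<omega>, (\<lambda>k\<in>{1..K}. private_data n Y U t k \<omega>))"

definition shared_space ::
  "nat \<Rightarrow> nat \<Rightarrow> (nat \<Rightarrow> 'y measure) \<Rightarrow> (nat \<Rightarrow> nat \<Rightarrow> 'u measure) \<Rightarrow> nat \<Rightarrow> ('y, 'u) common_data measure"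
  where "shared_space K n SY SU t =
    Pi\<^sub>M {s. s + n \<le> t} (\<lambda>s. Pi\<^sub>M {1..K} SY) \<Otimes>\<^sub>M Pi\<^sub>M {s. s + n \<le> t} (\<lambda>s. Pi\<^sub>M {1..K} (SU s))"

definition private_space ::
  "nat \<Rightarrow> (nat \<Rightarrow> 'y measure) \<Rightarrow> (nat \<Rightarrow> nat \<Rightarrow> 'u measure) \<Rightarrow> nat \<Rightarrow> nat \<Rightarrow> ('y, 'u) local_data measure"
  where "private_space n SY SU t k =
    Pi\<^sub>M {s. t < s + n \<and> s \<le> t} (\<lambda>s. SY k) \<Otimes>\<^sub>M Pi\<^sub>M {s. t < s + n \<and> s < t} (\<lambda>s. SU s k)"

definition data_space ::
  "nat \<Rightarrow> nat \<Rightarrow> (nat \<Rightarrow> 'y measure) \<Rightarrow> (nat \<Rightarrow> nat \<Rightarrow> 'u measure) \<Rightarrow> nat \<Rightarrow> ('y, 'u) data measure"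
  where "data_space K n SY SU t =
    shared_space K n SY SU t \<Otimes>\<^sub>M Pi\<^sub>M {1..K} (private_space n SY SU t)"

definition control_strategies ::
  "nat \<Rightarrow> nat \<Rightarrow> nat \<Rightarrow> (nat \<Rightarrow> 'y measure) \<Rightarrow> (nat \<Rightarrow> nat \<Rightarrow> 'u measure)
    \<Rightarrow> (nat \<Rightarrow> ('y, 'u) data \<Rightarrow> nat \<Rightarrow> 'u) set"
  where "control_strategies K T n SY SU =
    {g. \<forall>t<T. g t \<in> measurable (data_space K n SY SU t) (Pi\<^sub>M {1..K} (SU t))}"

text \<open>\<open>p d\<close> is (a version of) the conditional density, with respect to \<open>R\<close>, of \<open>V\<close> given \<open>D = d\<close>.\<close>

definition cond_density ::
  "'o measure \<Rightarrow> 'd measure \<Rightarrow> ('o \<Rightarrow> 'd) \<Rightarrow> 'v measure \<Rightarrow> ('o \<Rightarrow> 'v) \<Rightarrow> ('d \<Rightarrow> 'v \<Rightarrow> ennreal) \<Rightarrow> bool"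
  where "cond_density M S D R V p \<longleftrightarrow>
    D \<in> measurable M S \<and> V \<in> measurable M R \<and>
    (\<lambda>(d, v). p d v) \<in> borel_measurable (S \<Otimes>\<^sub>M R) \<and>
    (\<forall>A\<in>sets R. AE \<omega> in M.
      nn_cond_exp M (vimage_algebra (space M) D S) (indicator (V -` A \<inter> space M)) \<omega> =
      (\<integral>\<^sup>+v\<in>A. p (D \<omega>) v \<partial>R))"

definition information_state ::
  "'o measure \<Rightarrow> nat \<Rightarrow> nat \<Rightarrow> (nat \<Rightarrow> 'y measure) \<Rightarrow> (nat \<Rightarrow> nat \<Rightarrow> 'u measure) \<Rightarrow>
   (nat \<Rightarrow> ('x \<times> 'x) measure) \<Rightarrow>
   (nat \<Rightarrow> 'o \<Rightarrow> 'x) \<Rightarrow> (nat \<Rightarrow> 'o \<Rightarrow> 'x) \<Rightarrow>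
   (nat \<Rightarrow> 'o \<Rightarrow> nat \<Rightarrow> 'y) \<Rightarrow> (nat \<Rightarrow> 'o \<Rightarrow> nat \<Rightarrow> 'u) \<Rightarrow>
   nat \<Rightarrow> (('y, 'u) data \<Rightarrow> 'x \<times> 'x \<Rightarrow> ennreal) \<Rightarrow> bool"
  where "information_state M K n SY SU \<mu> X Xh Y U t p \<longleftrightarrow>
    cond_density M (data_space K n SY SU t) (model_data K n Y U t)
      (\<mu> t) (\<lambda>\<omega>. (X t \<omega>, Xh t \<omega>)) p"

text \<open>
  The primitive random variables have different value types, so their mutual independence is
  stated as independence of the generated \<open>\<sigma>\<close>-algebras, indexed by the following type.
\<close>

datatype source = Initial | Disturbance nat | Noise nat nat

definition sources :: "nat \<Rightarrow> nat \<Rightarrow> source set"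
  where "sources K T = {Initial} \<union> Disturbance ` {..<T} \<union> {Noise t k |t k. t \<le> T \<and> k \<in> {1..K}}"

fun source_events ::
  "'o measure \<Rightarrow> 'x measure \<Rightarrow> 'w measure \<Rightarrow> (nat \<Rightarrow> 'z measure) \<Rightarrow>
   ('o \<Rightarrow> 'x) \<Rightarrow> ('o \<Rightarrow> 'x) \<Rightarrow> (nat \<Rightarrow> 'o \<Rightarrow> 'w) \<Rightarrow> (nat \<Rightarrow> nat \<Rightarrow> 'o \<Rightarrow> 'z) \<Rightarrow> source \<Rightarrow> 'o set set"
  where
    "source_events M SX0 SW SZ X0 Xh0 W Z Initial =
      sets (vimage_algebra (space M) (\<lambda>\<omega>. (X0 \<omega>, Xh0 \<omega>)) (SX0 \<Otimes>\<^sub>M SX0))"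
  | "source_events M SX0 SW SZ X0 Xh0 W Z (Disturbance t) =
      sets (vimage_algebra (space M) (W t) SW)"
  | "source_events M SX0 SW SZ X0 Xh0 W Z (Noise t k) =
      sets (vimage_algebra (space M) (Z t k) (SZ k))"

end

theory Submission
  imports Defs
begin

text \<open>
  A conditional density of \<open>V\<close> given \<open>D\<close> is a disintegration of the joint law of \<open>(D, V)\<close>, so it
  can be propagated by Fubini.  Given the data at time \<open>t\<close>, the control \<open>U\<^sub>t\<close> is a known value and
  \<open>W\<^sub>t\<close> is independent of the past, so the joint state at time \<open>t + 1\<close> has the density obtained by
  integrating the transition density against \<open>\<Pi>\<^sub>t\<close>; Bayes' rule with the likelihood of \<open>Y\<^sub>t\<^sub>+\<^sub>1\<close>
  then conditions on the new observation.  The new data consist of the old data, \<open>U\<^sub>t\<close>, which is a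
  function of them, and \<open>Y\<^sub>t\<^sub>+\<^sub>1\<close>, so this is the information state at time \<open>t + 1\<close>.  The law
  \<open>g\<^sub>t\<close> enters only through the value of \<open>U\<^sub>t\<close>, which the data record, whence the independence of
  the strategy.  Almost sure uniqueness of conditional densities transfers the recursion to
  arbitrary versions.
\<close>

section \<open>Conditional densities\<close>

text \<open>\<open>nn_cond_exp\<close> is determined only up to a null set that varies with the
  event \<open>A\<close>, so the defining property cannot be handled pointwise in the data. It is
  therefore traded for equalities between integrals of test functions
  \<open>F (D \<omega>) (V \<omega>)\<close>, in which such null sets disappear. Strategy
  independence asks for one function \<open>\<pi>\<close> that serves all strategies at once. Under
  a fixed \<open>g\<close> the control given the data is \<open>g t d\<close>, which mentions
  \<open>g\<close>; the version finally exhibited reads the control out of the data at time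
  \<open>t + 1\<close> instead. The two agree on realized data only, and
  \<open>cond_density_transport\<close> is what permits the replacement. The hypothesis
  \<open>1 \<le> n\<close> keeps \<open>U t\<close> out of the data at time \<open>t\<close>; with
  \<open>n = 0\<close> the control at time \<open>t\<close> would be computed from itself.\<close>

context prob_space
begin

text \<open>The sets of the sigma-algebra generated by \<open>D\<close> are exactly the preimages of
  sets \<open>B \<in> sets S\<close>, so the averaging property of the conditional expectation over
  them is equality of the two measures on rectangles \<open>B \<times> A\<close>; rectangles form an
  intersection-stable generator.\<close>

lemma cond_density_disintegration:
  assumes R: "sigma_finite_measure R"
    and D[measurable]: "D \<in> measurable M S" and V[measurable]: "V \<in> measurable M R"
    and p[measurable]: "(\<lambda>(d, v). p d v) \<in> borel_measurable (S \<Otimes>\<^sub>M R)"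
  shows "cond_density M S D R V p \<longleftrightarrow>
    distr M (S \<Otimes>\<^sub>M R) (\<lambda>\<omega>. (D \<omega>, V \<omega>)) = density (distr M S D \<Otimes>\<^sub>M R) (\<lambda>(d, v). p d v)"
    (is "?L \<longleftrightarrow> ?J = ?P")
proof -
  interpret R: sigma_finite_measure R by fact
  let ?G = "vimage_algebra (space M) D S"
  have D': "D \<in> space M \<rightarrow> space S" using measurable_space[OF D] by auto
  have G: "subalgebra M ?G"
    unfolding subalgebra_def using sets_image_in_sets[OF refl D] by simp
  interpret G: finite_measure_subalgebra M ?G by standard (rule G)
  have DG[measurable]: "D \<in> measurable ?G S" by (rule measurable_vimage_algebra1[OF D'])
  have setsG: "sets ?G = {D -` B \<inter> space M |B. B \<in> sets S}" by (rule sets_vimage_algebra2[OF D'])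
  have J: "emeasure ?J (B \<times> A) =
      (\<integral>\<^sup>+\<omega>. indicator (D -` B \<inter> space M) \<omega> * indicator (V -` A \<inter> space M) \<omega> \<partial>M)"
    if [measurable]: "A \<in> sets R" "B \<in> sets S" for A B
    by (subst emeasure_distr)
      (auto simp: indicator_inter_arith[symmetric] nn_integral_indicator[symmetric]
        simp del: nn_integral_indicator intro!: nn_integral_cong split: split_indicator)
  have P: "emeasure ?P (B \<times> A) =
      (\<integral>\<^sup>+\<omega>. indicator (D -` B \<inter> space M) \<omega> * (\<integral>\<^sup>+v\<in>A. p (D \<omega>) v \<partial>R) \<partial>M)"
    if [measurable]: "A \<in> sets R" "B \<in> sets S" for A B
  proof -
    have "emeasure ?P (B \<times> A) =
        (\<integral>\<^sup>+z. (case z of (d, v) \<Rightarrow> p d v) * indicator (B \<times> A) z \<partial>(distr M S D \<Otimes>\<^sub>M R))"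
      by (rule emeasure_density) auto
    also have "\<dots> = (\<integral>\<^sup>+d. \<integral>\<^sup>+v. p d v * indicator (B \<times> A) (d, v) \<partial>R \<partial>distr M S D)"
      by (subst R.nn_integral_fst[symmetric]) auto
    also have "\<dots> = (\<integral>\<^sup>+d. indicator B d * (\<integral>\<^sup>+v\<in>A. p d v \<partial>R) \<partial>distr M S D)"
      by (auto simp: indicator_times mult_ac nn_integral_cmult[symmetric] intro!: nn_integral_cong)
    also have "\<dots> = (\<integral>\<^sup>+\<omega>. indicator B (D \<omega>) * (\<integral>\<^sup>+v\<in>A. p (D \<omega>) v \<partial>R) \<partial>M)"
      by (rule nn_integral_distr) auto
    finally show ?thesis
      by (auto intro!: nn_integral_cong simp: indicator_def)
  qed
  show ?thesis
  proof
    assume L: ?L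
    show "?J = ?P"
    proof (rule measure_eqI_generator_eq[where A="\<lambda>_. space S \<times> space R"])
      show "Int_stable {a \<times> b |a b. a \<in> sets S \<and> b \<in> sets R}" by (rule Int_stable_pair_measure_generator)
      show "{a \<times> b |a b. a \<in> sets S \<and> b \<in> sets R} \<subseteq> Pow (space S \<times> space R)"
        by (auto dest: sets.sets_into_space)
      show "sets ?J = sigma_sets (space S \<times> space R) {a \<times> b |a b. a \<in> sets S \<and> b \<in> sets R}"
        by (simp add: sets_pair_measure)
      show "sets ?P = sigma_sets (space S \<times> space R) {a \<times> b |a b. a \<in> sets S \<and> b \<in> sets R}"
        by (simp add: sets_pair_measure)
      show "emeasure ?J (space S \<times> space R) \<noteq> \<infinity>" for i :: nat
      proof -
        interpret J: prob_space ?J by (rule prob_space_distr) auto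
        show ?thesis by simp
      qed
      fix X assume "X \<in> {a \<times> b |a b. a \<in> sets S \<and> b \<in> sets R}"
      then obtain A B where [measurable]: "A \<in> sets R" "B \<in> sets S" and X: "X = B \<times> A" by auto
      have [measurable]: "D -` B \<inter> space M \<in> sets ?G" by (auto simp: setsG)
      have "emeasure ?J X = (\<integral>\<^sup>+\<omega>. indicator (D -` B \<inter> space M) \<omega> *
          nn_cond_exp M ?G (indicator (V -` A \<inter> space M)) \<omega> \<partial>M)"
        unfolding X by (subst J) (auto intro!: G.nn_cond_exp_intg[symmetric])
      also have "\<dots> = emeasure ?P X"
        unfolding X
      proof (subst P)
        have "AE \<omega> in M. nn_cond_exp M ?G (indicator (V -` A \<inter> space M)) \<omega> = (\<integral>\<^sup>+v\<in>A. p (D \<omega>) v \<partial>R)"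
          using L unfolding cond_density_def by auto
        then show "(\<integral>\<^sup>+\<omega>. indicator (D -` B \<inter> space M) \<omega> *
          nn_cond_exp M ?G (indicator (V -` A \<inter> space M)) \<omega> \<partial>M) =
          (\<integral>\<^sup>+\<omega>. indicator (D -` B \<inter> space M) \<omega> * (\<integral>\<^sup>+v\<in>A. p (D \<omega>) v \<partial>R) \<partial>M)"
          by (intro nn_integral_cong_AE) auto
      qed auto
      finally show "emeasure ?J X = emeasure ?P X" .
    qed auto
  next
    assume eq: "?J = ?P"
    show ?L
      unfolding cond_density_def
    proof (intro conjI ballI D V p)
      fix A assume [measurable]: "A \<in> sets R"
      have "AE \<omega> in M. (\<integral>\<^sup>+v\<in>A. p (D \<omega>) v \<partial>R) = nn_cond_exp M ?G (indicator (V -` A \<inter> space M)) \<omega>"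
      proof (rule G.nn_cond_exp_charact)
        fix C assume "C \<in> sets ?G"
        then obtain B where [measurable]: "B \<in> sets S" and C: "C = D -` B \<inter> space M"
          by (auto simp: setsG)
        show "(\<integral>\<^sup>+\<omega>\<in>C. indicator (V -` A \<inter> space M) \<omega> \<partial>M) = (\<integral>\<^sup>+\<omega>\<in>C. (\<integral>\<^sup>+v\<in>A. p (D \<omega>) v \<partial>R) \<partial>M)"
          using J[of A B] P[of A B] by (simp add: eq C mult.commute)
      qed measurable
      then show "AE \<omega> in M. nn_cond_exp M ?G (indicator (V -` A \<inter> space M)) \<omega> = (\<integral>\<^sup>+v\<in>A. p (D \<omega>) v \<partial>R)"
        by auto
    qed
  qed
qed

lemma cond_density_nn_integral:
  assumes R: "sigma_finite_measure R" and p: "cond_density M S D R V p"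
    and F[measurable]: "(\<lambda>(d, v). F d v) \<in> borel_measurable (S \<Otimes>\<^sub>M R)"
  shows "(\<integral>\<^sup>+\<omega>. F (D \<omega>) (V \<omega>) \<partial>M) = (\<integral>\<^sup>+\<omega>. \<integral>\<^sup>+v. p (D \<omega>) v * F (D \<omega>) v \<partial>R \<partial>M)"
proof -
  interpret R: sigma_finite_measure R by fact
  have [measurable]: "D \<in> measurable M S" "V \<in> measurable M R"
    "(\<lambda>(d, v). p d v) \<in> borel_measurable (S \<Otimes>\<^sub>M R)"
    using p unfolding cond_density_def by auto
  have "(\<integral>\<^sup>+\<omega>. F (D \<omega>) (V \<omega>) \<partial>M) =
      (\<integral>\<^sup>+z. (case z of (d, v) \<Rightarrow> F d v) \<partial>distr M (S \<Otimes>\<^sub>M R) (\<lambda>\<omega>. (D \<omega>, V \<omega>)))"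
    by (subst nn_integral_distr) auto
  also have "distr M (S \<Otimes>\<^sub>M R) (\<lambda>\<omega>. (D \<omega>, V \<omega>)) = density (distr M S D \<Otimes>\<^sub>M R) (\<lambda>(d, v). p d v)"
    using p by (subst (asm) cond_density_disintegration[OF R]) auto
  also have "(\<integral>\<^sup>+z. (case z of (d, v) \<Rightarrow> F d v) \<partial>\<dots>) =
      (\<integral>\<^sup>+z. (case z of (d, v) \<Rightarrow> p d v) * (case z of (d, v) \<Rightarrow> F d v) \<partial>(distr M S D \<Otimes>\<^sub>M R))"
    by (rule nn_integral_density) auto
  also have "\<dots> = (\<integral>\<^sup>+d. \<integral>\<^sup>+v. p d v * F d v \<partial>R \<partial>distr M S D)"
    by (subst R.nn_integral_fst[symmetric]) auto
  also have "\<dots> = (\<integral>\<^sup>+\<omega>. \<integral>\<^sup>+v. p (D \<omega>) v * F (D \<omega>) v \<partial>R \<partial>M)"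
    by (subst nn_integral_distr) auto
  finally show ?thesis .
qed

text \<open>Converse of \<open>cond_density_nn_integral\<close>: indicators are already enough test
  functions. The two together let the update rules be proved by rewriting integrals.\<close>

lemma cond_densityI:
  assumes R: "sigma_finite_measure R"
    and D[measurable]: "D \<in> measurable M S" and V[measurable]: "V \<in> measurable M R"
    and p[measurable]: "(\<lambda>(d, v). p d v) \<in> borel_measurable (S \<Otimes>\<^sub>M R)"
    and eq: "\<And>F. (\<lambda>(d, v). F d v) \<in> borel_measurable (S \<Otimes>\<^sub>M R) \<Longrightarrow>
      (\<integral>\<^sup>+\<omega>. F (D \<omega>) (V \<omega>) \<partial>M) = (\<integral>\<^sup>+\<omega>. \<integral>\<^sup>+v. p (D \<omega>) v * F (D \<omega>) v \<partial>R \<partial>M)"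
  shows "cond_density M S D R V p"
  unfolding cond_density_disintegration[OF R D V p]
proof (rule measure_eqI)
  interpret R: sigma_finite_measure R by fact
  let ?J = "distr M (S \<Otimes>\<^sub>M R) (\<lambda>\<omega>. (D \<omega>, V \<omega>))"
  let ?P = "density (distr M S D \<Otimes>\<^sub>M R) (\<lambda>(d, v). p d v)"
  show "sets ?J = sets ?P" by simp
  fix X assume "X \<in> sets ?J"
  then have [measurable]: "X \<in> sets (S \<Otimes>\<^sub>M R)" by simp
  have "emeasure ?J X = (\<integral>\<^sup>+z. indicator X z \<partial>?J)" by simp
  also have "\<dots> = (\<integral>\<^sup>+\<omega>. indicator X (D \<omega>, V \<omega>) \<partial>M)"
    by (subst nn_integral_distr) auto
  also have "\<dots> = (\<integral>\<^sup>+\<omega>. \<integral>\<^sup>+v. p (D \<omega>) v * indicator X (D \<omega>, v) \<partial>R \<partial>M)"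
    by (subst eq) auto
  also have "\<dots> = (\<integral>\<^sup>+d. \<integral>\<^sup>+v. p d v * indicator X (d, v) \<partial>R \<partial>distr M S D)"
    by (subst nn_integral_distr) auto
  also have "\<dots> = (\<integral>\<^sup>+z. (case z of (d, v) \<Rightarrow> p d v) * indicator X z \<partial>(distr M S D \<Otimes>\<^sub>M R))"
    by (subst R.nn_integral_fst[symmetric]) auto
  also have "\<dots> = emeasure ?P X"
    by (rule emeasure_density[symmetric]) auto
  finally show "emeasure ?J X = emeasure ?P X" .
qed

text \<open>Both versions are densities of the same joint law with respect to the product of the law
  of \<open>D\<close> and \<open>R\<close>. Sigma-finiteness makes them agree almost everywhere on
  the product, and slicing the null set yields the nested form.\<close>

lemma cond_density_AE_unique:
  assumes R: "sigma_finite_measure R"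
    and p: "cond_density M S D R V p" and q: "cond_density M S D R V q"
  shows "AE \<omega> in M. AE v in R. p (D \<omega>) v = q (D \<omega>) v"
proof -
  interpret R: sigma_finite_measure R by fact
  have [measurable]: "D \<in> measurable M S" "V \<in> measurable M R"
    "(\<lambda>(d, v). p d v) \<in> borel_measurable (S \<Otimes>\<^sub>M R)" "(\<lambda>(d, v). q d v) \<in> borel_measurable (S \<Otimes>\<^sub>M R)"
    using p q unfolding cond_density_def by auto
  interpret D: prob_space "distr M S D" by (rule prob_space_distr) simp
  interpret DR: pair_sigma_finite "distr M S D" R ..
  have "density (distr M S D \<Otimes>\<^sub>M R) (\<lambda>(d, v). p d v) = density (distr M S D \<Otimes>\<^sub>M R) (\<lambda>(d, v). q d v)"
    using p q by (simp add: cond_density_disintegration[OF R])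
  then have "AE z in distr M S D \<Otimes>\<^sub>M R. (case z of (d, v) \<Rightarrow> p d v) = (case z of (d, v) \<Rightarrow> q d v)"
    by (subst (asm) DR.density_unique_iff) auto
  then have "AE d in distr M S D. AE v in R. p d v = q d v"
    using DR.AE_pair by fastforce
  then show ?thesis by (rule AE_distrD[rotated]) simp
qed

text \<open>Passing from \<open>D\<close> to a function of \<open>D\<close> may lose information and
  then changes the density; it does not when \<open>p (D \<omega>)\<close> is already a function
  \<open>p'\<close> of the new data. This serves to re-encode the data and to swap
  \<open>g t d\<close> for the recorded control.\<close>

lemma cond_density_transport:
  assumes R: "sigma_finite_measure R" and p: "cond_density M S D R V p"
    and \<Phi>[measurable]: "\<Phi> \<in> measurable S S'"
    and D': "\<And>\<omega>. \<omega> \<in> space M \<Longrightarrow> D' \<omega> = \<Phi> (D \<omega>)"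
    and V': "\<And>\<omega>. \<omega> \<in> space M \<Longrightarrow> V' \<omega> = V \<omega>"
    and p'[measurable]: "(\<lambda>(d, v). p' d v) \<in> borel_measurable (S' \<Otimes>\<^sub>M R)"
    and eq: "\<And>\<omega>. \<omega> \<in> space M \<Longrightarrow> p' (D' \<omega>) = p (D \<omega>)"
  shows "cond_density M S' D' R V' p'"
proof (rule cond_densityI[OF R])
  have [measurable]: "D \<in> measurable M S" "V \<in> measurable M R"
    "(\<lambda>(d, v). p d v) \<in> borel_measurable (S \<Otimes>\<^sub>M R)"
    using p unfolding cond_density_def by auto
  show "D' \<in> measurable M S'" by (subst measurable_cong[OF D']) auto
  show "V' \<in> measurable M R" by (subst measurable_cong[OF V']) auto
  show "(\<lambda>(d, v). p' d v) \<in> borel_measurable (S' \<Otimes>\<^sub>M R)" by measurable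
  fix F :: "_ \<Rightarrow> _ \<Rightarrow> ennreal" assume F[measurable]: "(\<lambda>(d, v). F d v) \<in> borel_measurable (S' \<Otimes>\<^sub>M R)"
  have "(\<integral>\<^sup>+\<omega>. F (D' \<omega>) (V' \<omega>) \<partial>M) = (\<integral>\<^sup>+\<omega>. F (\<Phi> (D \<omega>)) (V \<omega>) \<partial>M)"
    by (intro nn_integral_cong) (simp add: D' V')
  also have "\<dots> = (\<integral>\<^sup>+\<omega>. \<integral>\<^sup>+v. p (D \<omega>) v * F (\<Phi> (D \<omega>)) v \<partial>R \<partial>M)"
    by (rule cond_density_nn_integral[OF R p]) measurable
  also have "\<dots> = (\<integral>\<^sup>+\<omega>. \<integral>\<^sup>+v. p' (D' \<omega>) v * F (D' \<omega>) v \<partial>R \<partial>M)"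
    by (intro nn_integral_cong) (simp add: eq D'[symmetric])
  finally show "(\<integral>\<^sup>+\<omega>. F (D' \<omega>) (V' \<omega>) \<partial>M) = (\<integral>\<^sup>+\<omega>. \<integral>\<^sup>+v. p' (D' \<omega>) v * F (D' \<omega>) v \<partial>R \<partial>M)" .
qed

text \<open>Trivial data of type \<open>unit\<close> let the first observation go through the same
  Bayes step as the later ones.\<close>

lemma cond_density_trivial:
  assumes R: "sigma_finite_measure R" and p: "distributed M R V p"
  shows "cond_density M (count_space {()}) (\<lambda>_. ()) R V (\<lambda>_. p)"
proof (rule cond_densityI[OF R])
  have [measurable]: "V \<in> measurable M R" "p \<in> borel_measurable R"
    using p by (auto simp: distributed_def)
  show "(\<lambda>_. ()) \<in> measurable M (count_space {()})" "V \<in> measurable M R" by auto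
  show "(\<lambda>(d, v). p v) \<in> borel_measurable (count_space {()} \<Otimes>\<^sub>M R)" by measurable
  fix F :: "_ \<Rightarrow> _ \<Rightarrow> ennreal" assume F[measurable]: "(\<lambda>(d, v). F d v) \<in> borel_measurable (count_space {()} \<Otimes>\<^sub>M R)"
  have "(\<lambda>v. F () v) \<in> borel_measurable R"
    using measurable_Pair2[OF F, of "()"] by simp
  then show "(\<integral>\<^sup>+\<omega>. F () (V \<omega>) \<partial>M) = (\<integral>\<^sup>+\<omega>. \<integral>\<^sup>+v. p v * F () v \<partial>R \<partial>M)"
    by (simp add: distributed_nn_integral[OF p] emeasure_space_1)
qed

text \<open>\<^const>\<open>indep_var\<close> requires both variables to have the same value type; this variant does not.\<close>

definition indep_pair :: "'b measure \<Rightarrow> ('a \<Rightarrow> 'b) \<Rightarrow> 'c measure \<Rightarrow> ('a \<Rightarrow> 'c) \<Rightarrow> bool"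
  where "indep_pair A Q B Z \<longleftrightarrow> random_variable A Q \<and> random_variable B Z \<and>
    distr M A Q \<Otimes>\<^sub>M distr M B Z = distr M (A \<Otimes>\<^sub>M B) (\<lambda>\<omega>. (Q \<omega>, Z \<omega>))"

text \<open>The inner integration runs over an independent copy \<open>\<omega>'\<close> while
  \<open>Q \<omega>\<close> is frozen; this gives access to densities that are assumed only for
  fixed states and controls.\<close>

lemma indep_pair_nn_integral:
  assumes ind: "indep_pair A Q B Z" and F[measurable]: "F \<in> borel_measurable (A \<Otimes>\<^sub>M B)"
  shows "(\<integral>\<^sup>+\<omega>. F (Q \<omega>, Z \<omega>) \<partial>M) = (\<integral>\<^sup>+\<omega>. \<integral>\<^sup>+\<omega>'. F (Q \<omega>, Z \<omega>') \<partial>M \<partial>M)"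
proof -
  have [measurable]: "Q \<in> measurable M A" "Z \<in> measurable M B"
    and eq: "distr M A Q \<Otimes>\<^sub>M distr M B Z = distr M (A \<Otimes>\<^sub>M B) (\<lambda>\<omega>. (Q \<omega>, Z \<omega>))"
    using ind by (auto simp: indep_pair_def)
  interpret Z: prob_space "distr M B Z" by (rule prob_space_distr) simp
  have "(\<integral>\<^sup>+\<omega>. F (Q \<omega>, Z \<omega>) \<partial>M) =
      (\<integral>\<^sup>+z. F z \<partial>distr M (A \<Otimes>\<^sub>M B) (\<lambda>\<omega>. (Q \<omega>, Z \<omega>)))"
    by (subst nn_integral_distr) auto
  also have "\<dots> = (\<integral>\<^sup>+a. \<integral>\<^sup>+b. F (a, b) \<partial>distr M B Z \<partial>distr M A Q)"
    unfolding eq[symmetric] by (subst Z.nn_integral_fst[symmetric]) auto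
  also have "\<dots> = (\<integral>\<^sup>+\<omega>. \<integral>\<^sup>+b. F (Q \<omega>, b) \<partial>distr M B Z \<partial>M)"
    by (subst nn_integral_distr) (auto intro!: Z.borel_measurable_nn_integral)
  also have "\<dots> = (\<integral>\<^sup>+\<omega>. \<integral>\<^sup>+\<omega>'. F (Q \<omega>, Z \<omega>') \<partial>M \<partial>M)"
    by (auto intro!: nn_integral_cong nn_integral_distr)
  finally show ?thesis .
qed

end

section \<open>Prediction and Bayes' rule\<close>

definition predict :: "'v measure \<Rightarrow> ('v \<Rightarrow> 'w \<Rightarrow> ennreal) \<Rightarrow> ('v \<Rightarrow> ennreal) \<Rightarrow> 'w \<Rightarrow> ennreal"
  where "predict R \<tau> \<rho> v' = (\<integral>\<^sup>+v. \<rho> v * \<tau> v v' \<partial>R)"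

text \<open>
  The normalising integral may be \<open>0\<close> or \<open>\<infinity>\<close>, where the quotient is meaningless; this happens only on
  a null set of observations.
\<close>

definition bayes_update :: "'v measure \<Rightarrow> ('v \<Rightarrow> 'y \<Rightarrow> ennreal) \<Rightarrow> ('v \<Rightarrow> ennreal) \<Rightarrow> 'y \<Rightarrow> 'v \<Rightarrow> ennreal"
  where "bayes_update R l \<rho> y v = \<rho> v * l v y / (\<integral>\<^sup>+v'. \<rho> v' * l v' y \<partial>R)"

context prob_space
begin

text \<open>\<open>predict\<close> is the Chapman-Kolmogorov integral. With \<open>(D, V)\<close>
  frozen, the noise integral becomes an integral against \<open>\<tau>\<close>, and Tonelli's
  theorem moves the new state outside. \<open>G\<close> and \<open>\<tau>\<close> take
  \<open>d\<close> as an argument because the control will be a function of the data.\<close>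

lemma cond_density_predict:
  assumes R: "sigma_finite_measure R" and R': "sigma_finite_measure R'"
    and p: "cond_density M S D R V p"
    and ind: "indep_pair (S \<Otimes>\<^sub>M R) (\<lambda>\<omega>. (D \<omega>, V \<omega>)) N W"
    and G[measurable]: "G \<in> measurable (S \<Otimes>\<^sub>M R \<Otimes>\<^sub>M N) R'"
    and \<tau>[measurable]: "\<tau> \<in> borel_measurable (S \<Otimes>\<^sub>M R \<Otimes>\<^sub>M R')"
    and dens: "\<And>d. d \<in> space S \<Longrightarrow> AE v in R. distributed M R' (\<lambda>\<omega>. G (d, v, W \<omega>)) (\<lambda>v'. \<tau> (d, v, v'))"
  shows "cond_density M S D R' (\<lambda>\<omega>. G (D \<omega>, V \<omega>, W \<omega>)) (\<lambda>d. predict R (\<lambda>v v'. \<tau> (d, v, v')) (p d))"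
proof (rule cond_densityI[OF R'])
  interpret R: sigma_finite_measure R by fact
  interpret R': sigma_finite_measure R' by fact
  interpret RR': pair_sigma_finite R R' ..
  have [measurable]: "D \<in> measurable M S" "V \<in> measurable M R" "(\<lambda>(d, v). p d v) \<in> borel_measurable (S \<Otimes>\<^sub>M R)"
    using p unfolding cond_density_def by auto
  have [measurable]: "W \<in> measurable M N" using ind by (simp add: indep_pair_def)
  show "D \<in> measurable M S" by simp
  show "(\<lambda>\<omega>. G (D \<omega>, V \<omega>, W \<omega>)) \<in> measurable M R'" by measurable
  show "(\<lambda>(d, v'). predict R (\<lambda>v v'. \<tau> (d, v, v')) (p d) v') \<in> borel_measurable (S \<Otimes>\<^sub>M R')"
    unfolding predict_def by measurable
  fix F :: "_ \<Rightarrow> _ \<Rightarrow> ennreal" assume F[measurable]: "(\<lambda>(d, v'). F d v') \<in> borel_measurable (S \<Otimes>\<^sub>M R')"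
  have "(\<integral>\<^sup>+\<omega>. F (D \<omega>) (G (D \<omega>, V \<omega>, W \<omega>)) \<partial>M) =
      (\<integral>\<^sup>+\<omega>. \<integral>\<^sup>+\<omega>'. F (D \<omega>) (G (D \<omega>, V \<omega>, W \<omega>')) \<partial>M \<partial>M)"
  proof -
    have "(\<lambda>x. F (fst (fst x)) (G (fst (fst x), snd (fst x), snd x))) \<in> borel_measurable ((S \<Otimes>\<^sub>M R) \<Otimes>\<^sub>M N)"
      by measurable
    from indep_pair_nn_integral[OF ind this] show ?thesis by simp
  qed
  also have "\<dots> = (\<integral>\<^sup>+\<omega>. \<integral>\<^sup>+v. p (D \<omega>) v * (\<integral>\<^sup>+\<omega>'. F (D \<omega>) (G (D \<omega>, v, W \<omega>')) \<partial>M) \<partial>R \<partial>M)"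
    by (rule cond_density_nn_integral[OF R p]) measurable
  also have "\<dots> = (\<integral>\<^sup>+\<omega>. \<integral>\<^sup>+v. \<integral>\<^sup>+v'. p (D \<omega>) v * (\<tau> (D \<omega>, v, v') * F (D \<omega>) v') \<partial>R' \<partial>R \<partial>M)"
  proof (rule nn_integral_cong, rule nn_integral_cong_AE)
    fix \<omega> assume "\<omega> \<in> space M"
    then have d[measurable]: "D \<omega> \<in> space S" by (rule measurable_space[rotated]) simp
    \<comment> \<open>The exceptional states \<open>v\<close> may depend on the data value
      \<open>D \<omega>\<close>; for each such value they form an \<open>R\<close>-null set, which
      the integral over \<open>v\<close> ignores.\<close>
    show "AE v in R. p (D \<omega>) v * (\<integral>\<^sup>+\<omega>'. F (D \<omega>) (G (D \<omega>, v, W \<omega>')) \<partial>M) =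
        (\<integral>\<^sup>+v'. p (D \<omega>) v * (\<tau> (D \<omega>, v, v') * F (D \<omega>) v') \<partial>R')"
      using dens[OF d] AE_space
    proof eventually_elim
      case (elim v)
      note [measurable] = \<open>v \<in> space R\<close>
      show ?case
        by (subst distributed_nn_integral[OF elim(1), symmetric]) (auto simp: nn_integral_cmult)
    qed
  qed
  also have "\<dots> = (\<integral>\<^sup>+\<omega>. \<integral>\<^sup>+v'. \<integral>\<^sup>+v. p (D \<omega>) v * (\<tau> (D \<omega>, v, v') * F (D \<omega>) v') \<partial>R \<partial>R' \<partial>M)"
    by (intro nn_integral_cong RR'.Fubini'[symmetric]) measurable
  also have "\<dots> = (\<integral>\<^sup>+\<omega>. \<integral>\<^sup>+v'. predict R (\<lambda>v v'. \<tau> (D \<omega>, v, v')) (p (D \<omega>)) v' * F (D \<omega>) v' \<partial>R' \<partial>M)"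
    unfolding predict_def by (auto simp: nn_integral_multc[symmetric] mult.assoc intro!: nn_integral_cong)
  finally show "(\<integral>\<^sup>+\<omega>. F (D \<omega>) (G (D \<omega>, V \<omega>, W \<omega>)) \<partial>M) =
      (\<integral>\<^sup>+\<omega>. \<integral>\<^sup>+v'. predict R (\<lambda>v v'. \<tau> (D \<omega>, v, v')) (p (D \<omega>)) v' * F (D \<omega>) v' \<partial>R' \<partial>M)" .
qed

text \<open>Given \<open>D\<close>, observation and state have the joint density
  \<open>p d v * l v y\<close>, and the posterior is this divided by its marginal in
  \<open>y\<close>. The work lies in justifying the cancellation where that marginal is
  \<open>0\<close> or infinite.\<close>

lemma cond_density_bayes_update:
  assumes R: "sigma_finite_measure R" and Q: "sigma_finite_measure Q"
    and p: "cond_density M S D R V p"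
    and ind: "indep_pair (S \<Otimes>\<^sub>M R) (\<lambda>\<omega>. (D \<omega>, V \<omega>)) N Z"
    and H[measurable]: "H \<in> measurable (R \<Otimes>\<^sub>M N) Q"
    and l[measurable]: "(\<lambda>(v, y). l v y) \<in> borel_measurable (R \<Otimes>\<^sub>M Q)"
    and dens: "AE v in R. distributed M Q (\<lambda>\<omega>. H (v, Z \<omega>)) (l v)"
  shows "cond_density M (S \<Otimes>\<^sub>M Q) (\<lambda>\<omega>. (D \<omega>, H (V \<omega>, Z \<omega>))) R V (\<lambda>(d, y). bayes_update R l (p d) y)"
proof (rule cond_densityI[OF R])
  interpret R: sigma_finite_measure R by fact
  interpret Q: sigma_finite_measure Q by fact
  interpret RQ: pair_sigma_finite R Q ..
  have [measurable]: "D \<in> measurable M S" "V \<in> measurable M R" "(\<lambda>(d, v). p d v) \<in> borel_measurable (S \<Otimes>\<^sub>M R)"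
    using p unfolding cond_density_def by auto
  have [measurable]: "Z \<in> measurable M N" using ind by (simp add: indep_pair_def)
  \<comment> \<open>\<open>E d\<close> is the conditional density of the new observation given
    \<open>D = d\<close>.\<close>
  define E where "E d y = (\<integral>\<^sup>+v. p d v * l v y \<partial>R)" for d y
  have [measurable]: "(\<lambda>(d, y). E d y) \<in> borel_measurable (S \<Otimes>\<^sub>M Q)"
    unfolding E_def by measurable
  have post: "bayes_update R l (p d) y v = p d v * l v y / E d y" for d y v
    by (simp add: bayes_update_def E_def)
  \<comment> \<open>This disintegrates the joint law of data, new observation and state. It is used
    three times: with the constant \<open>1\<close> to bound \<open>E\<close>, with the posterior
    integral, and with the test function itself.\<close>
  have key: "(\<integral>\<^sup>+\<omega>. F (D \<omega>, H (V \<omega>, Z \<omega>), V \<omega>) \<partial>M) =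
      (\<integral>\<^sup>+\<omega>. \<integral>\<^sup>+y. \<integral>\<^sup>+v. p (D \<omega>) v * l v y * F (D \<omega>, y, v) \<partial>R \<partial>Q \<partial>M)"
    if [measurable]: "F \<in> borel_measurable (S \<Otimes>\<^sub>M Q \<Otimes>\<^sub>M R)" for F
  proof -
    have "(\<integral>\<^sup>+\<omega>. F (D \<omega>, H (V \<omega>, Z \<omega>), V \<omega>) \<partial>M) =
        (\<integral>\<^sup>+\<omega>. \<integral>\<^sup>+\<omega>'. F (D \<omega>, H (V \<omega>, Z \<omega>'), V \<omega>) \<partial>M \<partial>M)"
    proof -
      have "(\<lambda>x. F (fst (fst x), H (snd (fst x), snd x), snd (fst x))) \<in> borel_measurable ((S \<Otimes>\<^sub>M R) \<Otimes>\<^sub>M N)"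
        by measurable
      from indep_pair_nn_integral[OF ind this] show ?thesis by simp
    qed
    also have "\<dots> = (\<integral>\<^sup>+\<omega>. \<integral>\<^sup>+v. p (D \<omega>) v * (\<integral>\<^sup>+\<omega>'. F (D \<omega>, H (v, Z \<omega>'), v) \<partial>M) \<partial>R \<partial>M)"
      by (rule cond_density_nn_integral[OF R p]) measurable
    also have "\<dots> = (\<integral>\<^sup>+\<omega>. \<integral>\<^sup>+v. \<integral>\<^sup>+y. p (D \<omega>) v * l v y * F (D \<omega>, y, v) \<partial>Q \<partial>R \<partial>M)"
    proof (rule nn_integral_cong, rule nn_integral_cong_AE)
      fix \<omega> assume "\<omega> \<in> space M"
      then have [measurable]: "D \<omega> \<in> space S" by (rule measurable_space[rotated]) simp
      show "AE v in R. p (D \<omega>) v * (\<integral>\<^sup>+\<omega>'. F (D \<omega>, H (v, Z \<omega>'), v) \<partial>M) =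
          (\<integral>\<^sup>+y. p (D \<omega>) v * l v y * F (D \<omega>, y, v) \<partial>Q)"
        using dens AE_space
      proof eventually_elim
        case (elim v)
        note [measurable] = \<open>v \<in> space R\<close>
        show ?case
          by (subst distributed_nn_integral[OF elim(1), symmetric])
            (auto simp: nn_integral_cmult mult.assoc)
      qed
    qed
    also have "\<dots> = (\<integral>\<^sup>+\<omega>. \<integral>\<^sup>+y. \<integral>\<^sup>+v. p (D \<omega>) v * l v y * F (D \<omega>, y, v) \<partial>R \<partial>Q \<partial>M)"
      by (intro nn_integral_cong RQ.Fubini'[symmetric]) measurable
    finally show ?thesis .
  qed
  show "(\<lambda>\<omega>. (D \<omega>, H (V \<omega>, Z \<omega>))) \<in> measurable M (S \<Otimes>\<^sub>M Q)" by measurable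
  show "V \<in> measurable M R" by simp
  show "(\<lambda>(d, v). (case d of (d, y) \<Rightarrow> bayes_update R l (p d) y) v) \<in> borel_measurable ((S \<Otimes>\<^sub>M Q) \<Otimes>\<^sub>M R)"
    unfolding post case_prod_beta by measurable
  have "(\<integral>\<^sup>+\<omega>. \<integral>\<^sup>+y. E (D \<omega>) y \<partial>Q \<partial>M) = 1"
    using key[of "\<lambda>_. 1"] by (simp add: E_def emeasure_space_1)
  \<comment> \<open>Total mass one excludes an infinite \<open>E\<close> outside a null set.\<close>
  then have "AE \<omega> in M. (\<integral>\<^sup>+y. E (D \<omega>) y \<partial>Q) \<noteq> \<infinity>"
    by (intro nn_integral_PInf_AE) auto
  then have fin: "AE \<omega> in M. AE y in Q. E (D \<omega>) y \<noteq> \<infinity>"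
    using AE_space
  proof eventually_elim
    case (elim \<omega>)
    from \<open>\<omega> \<in> space M\<close> have [measurable]: "D \<omega> \<in> space S" by (rule measurable_space[rotated]) simp
    show ?case using elim(1) by (intro nn_integral_PInf_AE) auto
  qed
  fix F :: "_ \<Rightarrow> _ \<Rightarrow> ennreal" assume F[measurable]: "(\<lambda>(d, v). F d v) \<in> borel_measurable ((S \<Otimes>\<^sub>M Q) \<Otimes>\<^sub>M R)"
  have "(\<integral>\<^sup>+\<omega>. \<integral>\<^sup>+v. (case (D \<omega>, H (V \<omega>, Z \<omega>)) of (d, y) \<Rightarrow> bayes_update R l (p d) y) v *
        F (D \<omega>, H (V \<omega>, Z \<omega>)) v \<partial>R \<partial>M) =
      (\<integral>\<^sup>+\<omega>. \<integral>\<^sup>+v'. p (D \<omega>) v' * l v' (H (V \<omega>, Z \<omega>)) / E (D \<omega>) (H (V \<omega>, Z \<omega>)) *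
        F (D \<omega>, H (V \<omega>, Z \<omega>)) v' \<partial>R \<partial>M)"
    by (simp add: post)
  also have "\<dots> = (\<integral>\<^sup>+\<omega>. \<integral>\<^sup>+y. \<integral>\<^sup>+v. p (D \<omega>) v * l v y *
      (\<integral>\<^sup>+v'. p (D \<omega>) v' * l v' y / E (D \<omega>) y * F (D \<omega>, y) v' \<partial>R) \<partial>R \<partial>Q \<partial>M)"
  proof -
    \<comment> \<open>This integrand ignores the state component, so integrating \<open>v\<close>
      out will produce the factor \<open>E\<close> in front of it.\<close>
    have "(\<lambda>x. \<integral>\<^sup>+v'. p (fst x) v' * l v' (fst (snd x)) / E (fst x) (fst (snd x)) * F (fst x, fst (snd x)) v' \<partial>R)
        \<in> borel_measurable (S \<Otimes>\<^sub>M Q \<Otimes>\<^sub>M R)"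
      by measurable
    from key[OF this] show ?thesis by simp
  qed
  also have "\<dots> = (\<integral>\<^sup>+\<omega>. \<integral>\<^sup>+y. \<integral>\<^sup>+v. p (D \<omega>) v * l v y * F (D \<omega>, y) v \<partial>R \<partial>Q \<partial>M)"
  proof (rule nn_integral_cong_AE)
    show "AE \<omega> in M. (\<integral>\<^sup>+y. \<integral>\<^sup>+v. p (D \<omega>) v * l v y *
        (\<integral>\<^sup>+v'. p (D \<omega>) v' * l v' y / E (D \<omega>) y * F (D \<omega>, y) v' \<partial>R) \<partial>R \<partial>Q) =
      (\<integral>\<^sup>+y. \<integral>\<^sup>+v. p (D \<omega>) v * l v y * F (D \<omega>, y) v \<partial>R \<partial>Q)"
      using fin AE_space
    proof eventually_elim
      case (elim \<omega>)
      from \<open>\<omega> \<in> space M\<close> have [measurable]: "D \<omega> \<in> space S" by (rule measurable_space[rotated]) simp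
      show ?case
      proof (rule nn_integral_cong_AE)
        show "AE y in Q. (\<integral>\<^sup>+v. p (D \<omega>) v * l v y *
            (\<integral>\<^sup>+v'. p (D \<omega>) v' * l v' y / E (D \<omega>) y * F (D \<omega>, y) v' \<partial>R) \<partial>R) =
          (\<integral>\<^sup>+v. p (D \<omega>) v * l v y * F (D \<omega>, y) v \<partial>R)"
          using elim(1) AE_space
        proof eventually_elim
          case (elim y)
          note [measurable] = \<open>y \<in> space Q\<close>
          let ?I = "\<integral>\<^sup>+v'. p (D \<omega>) v' * l v' y / E (D \<omega>) y * F (D \<omega>, y) v' \<partial>R"
          have lhs: "(\<integral>\<^sup>+v. p (D \<omega>) v * l v y * ?I \<partial>R) = E (D \<omega>) y * ?I"
            unfolding E_def by (rule nn_integral_multc) measurable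
          show ?case
          proof (cases "E (D \<omega>) y = 0")
            \<comment> \<open>Where \<open>E\<close> vanishes, \<open>p * l\<close> vanishes almost
              everywhere: both sides are \<open>0\<close> whatever value the quotient takes.\<close>
            case True
            then have "AE v in R. p (D \<omega>) v * l v y = 0"
              unfolding E_def by (subst (asm) nn_integral_0_iff_AE) auto
            then have z: "(\<integral>\<^sup>+v. p (D \<omega>) v * l v y * F (D \<omega>, y) v \<partial>R) = 0"
              by (subst nn_integral_0_iff_AE) auto
            show ?thesis unfolding lhs z by (simp only: True mult_zero_left)
          next
            case False
            have "E (D \<omega>) y * ?I = (\<integral>\<^sup>+v'. E (D \<omega>) y * (p (D \<omega>) v' * l v' y / E (D \<omega>) y * F (D \<omega>, y) v') \<partial>R)"
              by (rule nn_integral_cmult[symmetric]) measurable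
            also have "\<dots> = (\<integral>\<^sup>+v. p (D \<omega>) v * l v y * F (D \<omega>, y) v \<partial>R)"
            proof (rule nn_integral_cong)
              fix v
              \<comment> \<open>Cancellation in \<open>ennreal\<close> requires \<open>E\<close> to
                be both nonzero and finite.\<close>
              have "E (D \<omega>) y * (p (D \<omega>) v * l v y / E (D \<omega>) y) = p (D \<omega>) v * l v y"
                using False elim(1) by (simp add: ennreal_times_divide ennreal_mult_divide_eq mult.commute[of "E (D \<omega>) y"])
              then show "E (D \<omega>) y * (p (D \<omega>) v * l v y / E (D \<omega>) y * F (D \<omega>, y) v) = p (D \<omega>) v * l v y * F (D \<omega>, y) v"
                by (simp add: mult.assoc[symmetric])
            qed
            finally show ?thesis unfolding lhs .
          qed
        qed
      qed
    qed
  qed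
  also have "\<dots> = (\<integral>\<^sup>+\<omega>. F (D \<omega>, H (V \<omega>, Z \<omega>)) (V \<omega>) \<partial>M)"
  proof -
    have "(\<lambda>x. F (fst x, fst (snd x)) (snd (snd x))) \<in> borel_measurable (S \<Otimes>\<^sub>M Q \<Otimes>\<^sub>M R)"
      by measurable
    from key[OF this] show ?thesis by simp
  qed
  finally show "(\<integral>\<^sup>+\<omega>. F (D \<omega>, H (V \<omega>, Z \<omega>)) (V \<omega>) \<partial>M) =
    (\<integral>\<^sup>+\<omega>. \<integral>\<^sup>+v. (case (D \<omega>, H (V \<omega>, Z \<omega>)) of (d, y) \<Rightarrow> bayes_update R l (p d) y) v *
        F (D \<omega>, H (V \<omega>, Z \<omega>)) v \<partial>R \<partial>M)" by simp
qed

section \<open>Product densities and independence of blocks of sources\<close>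

lemma distributed_PiM_indep_vars:
  assumes I[simp]: "finite I" and Q: "\<And>i. i \<in> I \<Longrightarrow> sigma_finite_measure (Q i)"
    and ind: "indep_vars Q Y I" and l: "\<And>i. i \<in> I \<Longrightarrow> distributed M (Q i) (Y i) (l i)"
  shows "distributed M (Pi\<^sub>M I Q) (\<lambda>\<omega>. \<lambda>i\<in>I. Y i \<omega>) (\<lambda>y. \<Prod>i\<in>I. l i (y i))"
proof -
  have Y[measurable]: "i \<in> I \<Longrightarrow> Y i \<in> measurable M (Q i)" and l'[measurable]: "i \<in> I \<Longrightarrow> l i \<in> borel_measurable (Q i)"
    and dens: "i \<in> I \<Longrightarrow> distr M (Q i) (Y i) = density (Q i) (l i)" for i
    using l[of i] by (auto simp: distributed_def)
  \<comment> \<open>The product measure locales speak about all indices, so the factors outside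
    \<open>I\<close> are filled in harmlessly: the measure on the empty space for \<open>Q'\<close>,
    a point mass for \<open>N\<close>. The product over \<open>I\<close> does not see them.\<close>
  define Q' where "Q' i = (if i \<in> I then Q i else count_space {})" for i
  define N where "N i = (if i \<in> I then distr M (Q i) (Y i) else return (count_space UNIV) undefined)" for i
  have Q'Q: "Pi\<^sub>M I Q' = Pi\<^sub>M I Q" by (rule PiM_cong) (auto simp: Q'_def)
  have "sigma_finite_measure (Q' i)" for i
    by (simp add: Q'_def Q sigma_finite_measure_count_space_finite)
  then interpret Q': product_sigma_finite Q'
    by (simp add: product_sigma_finite_def)
  have "prob_space (N i)" for i
    by (auto simp: N_def intro!: prob_space_distr prob_space_return)
  then interpret N: product_prob_space N
    by (intro product_prob_spaceI)
  have setsN: "sets (Pi\<^sub>M I N) = sets (Pi\<^sub>M I Q)"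
    by (rule sets_PiM_cong) (auto simp: N_def)
  have [measurable]: "(\<lambda>\<omega>. \<lambda>i\<in>I. Y i \<omega>) \<in> measurable M (Pi\<^sub>M I Q)" by measurable
  \<comment> \<open>Law and density are compared through the product of the marginals
    \<open>N\<close>, which is determined by its values on boxes: independence evaluates the law
    there, and the density integral factorizes.\<close>
  have "distr M (Pi\<^sub>M I Q) (\<lambda>\<omega>. \<lambda>i\<in>I. Y i \<omega>) = Pi\<^sub>M I N"
  proof (rule N.PiM_eqI)
    fix A assume "\<And>i. i \<in> I \<Longrightarrow> A i \<in> sets (N i)"
    then have A[measurable]: "\<And>i. i \<in> I \<Longrightarrow> A i \<in> sets (Q i)" by (auto simp: N_def split: if_splits)
    have "emeasure (distr M (Pi\<^sub>M I Q) (\<lambda>\<omega>. \<lambda>i\<in>I. Y i \<omega>)) (Pi\<^sub>E I A) =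
        emeasure M ((\<lambda>\<omega>. \<lambda>i\<in>I. Y i \<omega>) -` Pi\<^sub>E I A \<inter> space M)"
      by (rule emeasure_distr) (auto intro!: sets_PiM_I_finite A)
    also have "\<dots> = (\<Prod>i\<in>I. emeasure M (Y i -` A i \<inter> space M))"
    proof (cases "I = {}")
      \<comment> \<open>\<open>indep_varsD_finite\<close> needs a nonempty index set; for
        \<open>I = {}\<close> the only vector lies in the only box.\<close>
      case True
      then have "(\<lambda>\<omega>. \<lambda>i\<in>I. Y i \<omega>) -` Pi\<^sub>E I A \<inter> space M = space M"
        by (auto simp: restrict_def)
      then show ?thesis using True by (simp add: emeasure_space_1)
    next
      case False
      have "(\<lambda>\<omega>. \<lambda>i\<in>I. Y i \<omega>) -` Pi\<^sub>E I A \<inter> space M = (\<Inter>i\<in>I. Y i -` A i \<inter> space M)"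
        using False by (auto simp: PiE_iff)
      then show ?thesis
        using indep_varsD_finite[OF ind False I A] by (simp add: emeasure_eq_measure prod_ennreal)
    qed
    also have "\<dots> = (\<Prod>i\<in>I. emeasure (N i) (A i))"
      by (intro prod.cong) (auto simp: N_def emeasure_distr)
    finally show "emeasure (distr M (Pi\<^sub>M I Q) (\<lambda>\<omega>. \<lambda>i\<in>I. Y i \<omega>)) (Pi\<^sub>E I A) =
      (\<Prod>i\<in>I. emeasure (N i) (A i))" .
  qed (auto simp: setsN)
  also have "Pi\<^sub>M I N = density (Pi\<^sub>M I Q) (\<lambda>y. \<Prod>i\<in>I. l i (y i))"
  proof (rule N.PiM_eqI[symmetric])
    fix A assume "\<And>i. i \<in> I \<Longrightarrow> A i \<in> sets (N i)"
    then have A[measurable]: "\<And>i. i \<in> I \<Longrightarrow> A i \<in> sets (Q i)" by (auto simp: N_def split: if_splits)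
    have [measurable]: "Pi\<^sub>E I A \<in> sets (Pi\<^sub>M I Q)" by (auto intro!: sets_PiM_I_finite A)
    have "emeasure (density (Pi\<^sub>M I Q) (\<lambda>y. \<Prod>i\<in>I. l i (y i))) (Pi\<^sub>E I A) =
        (\<integral>\<^sup>+y. (\<Prod>i\<in>I. l i (y i)) * indicator (Pi\<^sub>E I A) y \<partial>Pi\<^sub>M I Q)"
      by (rule emeasure_density) measurable
    also have "\<dots> = (\<integral>\<^sup>+y. (\<Prod>i\<in>I. l i (y i) * indicator (A i) (y i)) \<partial>Pi\<^sub>M I Q')"
      unfolding Q'Q
    proof (rule nn_integral_cong)
      fix y assume "y \<in> space (Pi\<^sub>M I Q)"
      then have "indicator (Pi\<^sub>E I A) y = (\<Prod>i\<in>I. indicator (A i) (y i) :: ennreal)"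
        by (auto simp: indicator_def space_PiM PiE_iff)
      then show "(\<Prod>i\<in>I. l i (y i)) * indicator (Pi\<^sub>E I A) y = (\<Prod>i\<in>I. l i (y i) * indicator (A i) (y i))"
        by (simp add: prod.distrib)
    qed
    also have "\<dots> = (\<Prod>i\<in>I. \<integral>\<^sup>+y. l i y * indicator (A i) y \<partial>Q' i)"
      by (rule Q'.product_nn_integral_prod) (auto simp: Q'_def)
    also have "\<dots> = (\<Prod>i\<in>I. emeasure (N i) (A i))"
      by (intro prod.cong) (auto simp: N_def Q'_def dens emeasure_density)
    finally show "emeasure (density (Pi\<^sub>M I Q) (\<lambda>y. \<Prod>i\<in>I. l i (y i))) (Pi\<^sub>E I A) =
      (\<Prod>i\<in>I. emeasure (N i) (A i))" .
  qed (auto simp: setsN)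
  finally show ?thesis
    unfolding distributed_def by (intro conjI) measurable
qed

text \<open>Independence of intersection-stable families passes to the sigma-algebras generated by
  disjoint blocks of them. Hence whatever is computed from past sources is independent of a fresh
  source, although independence is assumed of the sources only.\<close>

lemma indep_pair_collect_sigma:
  assumes E: "indep_sets E L" and stable: "\<And>i. i \<in> L \<Longrightarrow> Int_stable (E i)"
    and IJ: "I \<subseteq> L" "J \<subseteq> L" "I \<inter> J = {}"
    and X: "X \<in> measurable (sigma (space M) (\<Union>i\<in>I. E i)) A"
    and Y: "Y \<in> measurable (sigma (space M) (\<Union>i\<in>J. E i)) B"
  shows "indep_pair A X B Y"
proof -
  have ev: "E i \<subseteq> events" if "i \<in> L" for i using E that by (auto simp: indep_sets_def)
  have *: "Z \<in> measurable M N \<and>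
      sigma_sets (space M) {Z -` C \<inter> space M |C. C \<in> sets N} \<subseteq> sigma_sets (space M) (\<Union>i\<in>I'. E i)"
    if Z: "Z \<in> measurable (sigma (space M) (\<Union>i\<in>I'. E i)) N" and I': "I' \<subseteq> L" for Z :: "'a \<Rightarrow> 'z" and N I'
  proof
    have sub: "(\<Union>i\<in>I'. E i) \<subseteq> events" using ev I' by auto
    then have pow: "(\<Union>i\<in>I'. E i) \<subseteq> Pow (space M)" using sets.space_closed by blast
    have "sets (sigma (space M) (\<Union>i\<in>I'. E i)) \<subseteq> events"
      using sub pow by (simp add: sets.sigma_sets_subset)
    then show "Z \<in> measurable M N"
      using Z pow measurable_mono[of N N "sigma (space M) (\<Union>i\<in>I'. E i)" M] by auto
    show "sigma_sets (space M) {Z -` C \<inter> space M |C. C \<in> sets N} \<subseteq> sigma_sets (space M) (\<Union>i\<in>I'. E i)"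
      using measurable_sets[OF Z] pow by (intro sigma_sets_mono) auto
  qed
  have "indep_sets (\<lambda>b. sigma_sets (space M) (\<Union>i\<in>case_bool I J b. E i)) UNIV"
  proof (rule indep_sets_collect_sigma)
    show "indep_sets E (\<Union>b\<in>UNIV. case_bool I J b)"
      using IJ by (intro indep_sets_mono_index[OF _ E]) (auto split: bool.splits)
    show "Int_stable (E i)" if "i \<in> case_bool I J b" for i b
      using that IJ stable by (auto split: bool.splits)
    show "disjoint_family (case_bool I J)"
      using IJ by (auto simp: disjoint_family_on_def split: bool.split)
  qed
  then have "indep_sets (case_bool (sigma_sets (space M) {X -` C \<inter> space M |C. C \<in> sets A})
      (sigma_sets (space M) {Y -` C \<inter> space M |C. C \<in> sets B})) UNIV"
    by (rule indep_sets_mono_sets) (use *[OF X IJ(1)] *[OF Y IJ(2)] in \<open>auto split: bool.split\<close>)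
  then have ind: "indep_set (sigma_sets (space M) {X -` C \<inter> space M |C. C \<in> sets A})
      (sigma_sets (space M) {Y -` C \<inter> space M |C. C \<in> sets B})"
    by (simp add: indep_set_def)
  have [measurable]: "random_variable A X" "random_variable B Y"
    using *[OF X IJ(1)] *[OF Y IJ(2)] by auto
  interpret X: prob_space "distr M A X" by (rule prob_space_distr) simp
  interpret Y: prob_space "distr M B Y" by (rule prob_space_distr) simp
  have "distr M A X \<Otimes>\<^sub>M distr M B Y = distr M (A \<Otimes>\<^sub>M B) (\<lambda>\<omega>. (X \<omega>, Y \<omega>))"
  proof (rule pair_measure_eqI)
    fix C C' assume "C \<in> sets (distr M A X)" "C' \<in> sets (distr M B Y)"
    then have C[measurable]: "C \<in> sets A" "C' \<in> sets B" by auto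
    have "prob ((X -` C \<inter> space M) \<inter> (Y -` C' \<inter> space M)) = prob (X -` C \<inter> space M) * prob (Y -` C' \<inter> space M)"
      using C by (intro indep_setD[OF ind] sigma_sets.Basic) auto
    also have "(X -` C \<inter> space M) \<inter> (Y -` C' \<inter> space M) = (\<lambda>\<omega>. (X \<omega>, Y \<omega>)) -` (C \<times> C') \<inter> space M"
      by auto
    finally show "emeasure (distr M A X) C * emeasure (distr M B Y) C' =
        emeasure (distr M (A \<Otimes>\<^sub>M B) (\<lambda>\<omega>. (X \<omega>, Y \<omega>))) (C \<times> C')"
      by (simp add: emeasure_distr emeasure_eq_measure ennreal_mult)
  qed (auto intro: X.sigma_finite_measure_axioms Y.sigma_finite_measure_axioms)
  then show ?thesis
    by (simp add: indep_pair_def)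
qed

end

section \<open>Reading trajectories off the data\<close>

text \<open>
  The data at time \<open>t\<close> contain every \<open>Y\<^sub>s\<close> with \<open>s \<le> t\<close> and every \<open>U\<^sub>s\<close> with \<open>s < t\<close>, in the shared
  or in the private part according to the delay.
\<close>

definition data_Y :: "nat \<Rightarrow> nat \<Rightarrow> nat \<Rightarrow> ('y, 'u) data \<Rightarrow> nat \<Rightarrow> nat \<Rightarrow> 'y"
  where "data_Y K n t d s = (if s + n \<le> t then fst (fst d) s else (\<lambda>k\<in>{1..K}. fst (snd d k) s))"

definition data_U :: "nat \<Rightarrow> nat \<Rightarrow> nat \<Rightarrow> ('y, 'u) data \<Rightarrow> nat \<Rightarrow> nat \<Rightarrow> 'u"
  where "data_U K n t d s = (if s + n \<le> t then snd (fst d) s else (\<lambda>k\<in>{1..K}. snd (snd d k) s))"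

text \<open>The private branch reassembles the vector as a restriction to \<open>{1..K}\<close>;
  hence the requirement that \<open>Y s \<omega>\<close> be extensional.\<close>

lemma data_Y_model_data:
  assumes "s \<le> t" and "Y s \<omega> \<in> extensional {1..K}"
  shows "data_Y K n t (model_data K n Y U t \<omega>) s = Y s \<omega>"
  using assms
  by (auto simp: data_Y_def model_data_def shared_data_def private_data_def extensional_def fun_eq_iff)

lemma data_U_model_data:
  assumes "s < t" and "U s \<omega> \<in> extensional {1..K}"
  shows "data_U K n t (model_data K n Y U t \<omega>) s = U s \<omega>"
  using assms
  by (auto simp: data_U_def model_data_def shared_data_def private_data_def extensional_def fun_eq_iff)

text \<open>For \<open>1 \<le> n\<close> the shared times \<open>s + n \<le> t\<close> satisfy
  \<open>s < t\<close>, so agreement of the controls strictly before \<open>t\<close>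
  suffices.\<close>

lemma model_data_cong:
  assumes "1 \<le> n" and "\<And>s. s \<le> t \<Longrightarrow> Y s \<omega> = Y' s \<omega>'" and "\<And>s. s < t \<Longrightarrow> U s \<omega> = U' s \<omega>'"
  shows "model_data K n Y U t \<omega> = model_data K n Y' U' t \<omega>'"
  using assms
  by (auto simp: model_data_def shared_data_def private_data_def fun_eq_iff)

lemma measurable_model_data:
  assumes n: "1 \<le> n"
    and Y: "\<And>s. s \<le> t \<Longrightarrow> Y s \<in> measurable N (Pi\<^sub>M {1..K} SY)"
    and U: "\<And>s. s < t \<Longrightarrow> U s \<in> measurable N (Pi\<^sub>M {1..K} (SU s))"
  shows "model_data K n Y U t \<in> measurable N (data_space K n SY SU t)"
  unfolding model_data_def[abs_def] data_space_def shared_data_def private_data_def shared_space_def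
    private_space_def
proof (intro measurable_Pair measurable_restrict)
  fix s assume "s \<in> {s. s + n \<le> t}"
  then show "(\<lambda>\<omega>. Y s \<omega>) \<in> measurable N (Pi\<^sub>M {1..K} SY)" "(\<lambda>\<omega>. U s \<omega>) \<in> measurable N (Pi\<^sub>M {1..K} (SU s))"
    using n Y[of s] U[of s] by auto
next
  fix k s assume k: "k \<in> {1..K}"
  show "(\<lambda>\<omega>. Y s \<omega> k) \<in> measurable N (SY k)" if "s \<in> {s. t < s + n \<and> s \<le> t}"
    using measurable_compose[OF Y measurable_component_singleton[OF k]] that by simp
  show "(\<lambda>\<omega>. U s \<omega> k) \<in> measurable N (SU s k)" if "s \<in> {s. t < s + n \<and> s < t}"
    using measurable_compose[OF U measurable_component_singleton[OF k]] that by simp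
qed

lemma measurable_data_Y:
  assumes s: "s \<le> t"
  shows "(\<lambda>d. data_Y K n t d s) \<in> measurable (data_space K n SY SU t) (Pi\<^sub>M {1..K} SY)"
proof (cases "s + n \<le> t")
  case True
  then have [measurable]: "s \<in> {s. s + n \<le> t}" by simp
  from True show ?thesis
    unfolding data_Y_def data_space_def shared_space_def by simp
next
  case False
  then have [measurable]: "s \<in> {s. t < s + n \<and> s \<le> t}" using s by simp
  from False show ?thesis
    unfolding data_Y_def data_space_def private_space_def by simp
qed

lemma measurable_data_U:
  assumes s: "s < t"
  shows "(\<lambda>d. data_U K n t d s) \<in> measurable (data_space K n SY SU t) (Pi\<^sub>M {1..K} (SU s))"
proof (cases "s + n \<le> t")
  case True
  then have [measurable]: "s \<in> {s. s + n \<le> t}" by simp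
  from True show ?thesis
    unfolding data_U_def data_space_def shared_space_def by simp
next
  case False
  then have [measurable]: "s \<in> {s. t < s + n \<and> s < t}" using s by simp
  from False show ?thesis
    unfolding data_U_def data_space_def private_space_def by simp
qed

section \<open>The filter of the controlled system\<close>

text \<open>The witness for \<open>\<phi>\<close>: it is built from reference measures and model
  densities and takes no strategy. The likelihood looks only at \<open>fst v\<close> because
  observations come from the model state, and it is a product because the noises are independent
  across subsystems.\<close>

definition filter_step ::
  "nat \<Rightarrow> (nat \<Rightarrow> ('x \<times> 'x) measure) \<Rightarrow> (nat \<Rightarrow> 'x \<times> 'x \<Rightarrow> (nat \<Rightarrow> 'u) \<Rightarrow> 'x \<times> 'x \<Rightarrow> ennreal)
    \<Rightarrow> (nat \<Rightarrow> nat \<Rightarrow> 'x \<Rightarrow> 'y \<Rightarrow> ennreal)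
    \<Rightarrow> nat \<Rightarrow> ('x \<times> 'x \<Rightarrow> ennreal) \<Rightarrow> (nat \<Rightarrow> 'y) \<Rightarrow> (nat \<Rightarrow> 'u) \<Rightarrow> 'x \<times> 'x \<Rightarrow> ennreal"
  where "filter_step K \<mu> p_trans p_obs t \<rho> y u =
    bayes_update (\<mu> (Suc t)) (\<lambda>v y. \<Prod>k\<in>{1..K}. p_obs (Suc t) k (fst v) (y k))
      (predict (\<mu> t) (\<lambda>v. p_trans t v u) \<rho>) y"

text \<open>Between \<open>t\<close> and \<open>t + 1\<close> entries move from the private to the
  shared part. Rebuilding the older data from the trajectories avoids tracking this
  migration.\<close>

definition prefix_data :: "nat \<Rightarrow> nat \<Rightarrow> nat \<Rightarrow> ('y, 'u) data \<Rightarrow> ('y, 'u) data"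
  where "prefix_data K n t =
    model_data K n (\<lambda>s d. data_Y K n (Suc t) d s) (\<lambda>s d. data_U K n (Suc t) d s) t"

text \<open>A single strategy \<open>g\<close> is fixed. Instances for different \<open>g\<close>
  share the model, the noises and all densities, so a formula built from these alone is common to
  all of them.\<close>

locale controlled_system = prob_space M
  for M :: "'o measure" +
  fixes K T n :: nat
    and SX :: "nat \<Rightarrow> 'x measure" and SU :: "nat \<Rightarrow> nat \<Rightarrow> 'u measure"
    and SW :: "'w measure" and SY :: "nat \<Rightarrow> 'y measure" and SZ :: "nat \<Rightarrow> 'z measure"
    and f fh :: "nat \<Rightarrow> 'x \<Rightarrow> (nat \<Rightarrow> 'u) \<Rightarrow> 'w \<Rightarrow> 'x"
    and h :: "nat \<Rightarrow> nat \<Rightarrow> 'x \<Rightarrow> 'z \<Rightarrow> 'y"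
    and X0 Xh0 :: "'o \<Rightarrow> 'x" and W :: "nat \<Rightarrow> 'o \<Rightarrow> 'w" and Z :: "nat \<Rightarrow> nat \<Rightarrow> 'o \<Rightarrow> 'z"
    and \<mu> :: "nat \<Rightarrow> ('x \<times> 'x) measure"
    and p_init :: "'x \<times> 'x \<Rightarrow> ennreal"
    and p_trans :: "nat \<Rightarrow> 'x \<times> 'x \<Rightarrow> (nat \<Rightarrow> 'u) \<Rightarrow> 'x \<times> 'x \<Rightarrow> ennreal"
    and p_obs :: "nat \<Rightarrow> nat \<Rightarrow> 'x \<Rightarrow> 'y \<Rightarrow> ennreal"
    and g :: "nat \<Rightarrow> ('y, 'u) data \<Rightarrow> nat \<Rightarrow> 'u"
    and X Xh :: "nat \<Rightarrow> 'o \<Rightarrow> 'x"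
    and Y :: "nat \<Rightarrow> 'o \<Rightarrow> nat \<Rightarrow> 'y"
    and U :: "nat \<Rightarrow> 'o \<Rightarrow> nat \<Rightarrow> 'u"
  assumes n: "1 \<le> n" and g: "g \<in> control_strategies K T n SY SU"
    and f: "t < T \<Longrightarrow> (\<lambda>(x, u, w). f t x u w)
          \<in> measurable (SX t \<Otimes>\<^sub>M Pi\<^sub>M {1..K} (SU t) \<Otimes>\<^sub>M SW) (SX (Suc t))"
    and fh: "t < T \<Longrightarrow> (\<lambda>(x, u, w). fh t x u w)
          \<in> measurable (SX t \<Otimes>\<^sub>M Pi\<^sub>M {1..K} (SU t) \<Otimes>\<^sub>M SW) (SX (Suc t))"
    and h: "t \<le> T \<Longrightarrow> k \<in> {1..K} \<Longrightarrow> (\<lambda>(x, z). h t k x z)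
          \<in> measurable (SX t \<Otimes>\<^sub>M SZ k) (SY k)"
    and X0: "X0 \<in> measurable M (SX 0)" and Xh0: "Xh0 \<in> measurable M (SX 0)"
    and W: "t < T \<Longrightarrow> W t \<in> measurable M SW"
    and Z: "t \<le> T \<Longrightarrow> k \<in> {1..K} \<Longrightarrow> Z t k \<in> measurable M (SZ k)"
    and indep: "indep_sets (source_events M (SX 0) SW SZ X0 Xh0 W Z) (sources K T)"
    and \<mu>: "t \<le> T \<Longrightarrow> sigma_finite_measure (\<mu> t)"
    and sets_\<mu>: "t \<le> T \<Longrightarrow> sets (\<mu> t) = sets (SX t \<Otimes>\<^sub>M SX t)"
    and SY: "k \<in> {1..K} \<Longrightarrow> sigma_finite_measure (SY k)"
    and p_init: "distributed M (\<mu> 0) (\<lambda>\<omega>. (X0 \<omega>, Xh0 \<omega>)) p_init"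
    and p_trans: "t < T \<Longrightarrow> (\<lambda>(x, u, x'). p_trans t x u x')
          \<in> borel_measurable (\<mu> t \<Otimes>\<^sub>M Pi\<^sub>M {1..K} (SU t) \<Otimes>\<^sub>M \<mu> (Suc t))"
    and trans: "t < T \<Longrightarrow> u \<in> space (Pi\<^sub>M {1..K} (SU t)) \<Longrightarrow>
          AE (x, xh) in \<mu> t. distributed M (\<mu> (Suc t))
            (\<lambda>\<omega>. (f t x u (W t \<omega>), fh t xh u (W t \<omega>))) (p_trans t (x, xh) u)"
    and p_obs: "t \<le> T \<Longrightarrow> k \<in> {1..K} \<Longrightarrow> (\<lambda>(x, y). p_obs t k x y)
          \<in> borel_measurable (SX t \<Otimes>\<^sub>M SY k)"
    and obs: "t \<le> T \<Longrightarrow> k \<in> {1..K} \<Longrightarrow>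
          AE (x, xh) in \<mu> t. distributed M (SY k) (\<lambda>\<omega>. h t k x (Z t k \<omega>)) (p_obs t k x)"
    and X_0: "\<omega> \<in> space M \<Longrightarrow> X 0 \<omega> = X0 \<omega>"
    and Xh_0: "\<omega> \<in> space M \<Longrightarrow> Xh 0 \<omega> = Xh0 \<omega>"
    and X_Suc: "t < T \<Longrightarrow> \<omega> \<in> space M \<Longrightarrow> X (Suc t) \<omega> = f t (X t \<omega>) (U t \<omega>) (W t \<omega>)"
    and Xh_Suc: "t < T \<Longrightarrow> \<omega> \<in> space M \<Longrightarrow> Xh (Suc t) \<omega> = fh t (Xh t \<omega>) (U t \<omega>) (W t \<omega>)"
    and Y_eq: "t \<le> T \<Longrightarrow> \<omega> \<in> space M \<Longrightarrow> Y t \<omega> = (\<lambda>k\<in>{1..K}. h t k (X t \<omega>) (Z t k \<omega>))"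
    and U_eq: "t < T \<Longrightarrow> \<omega> \<in> space M \<Longrightarrow> U t \<omega> = g t (model_data K n Y U t \<omega>)"
begin

abbreviation "S t \<equiv> data_space K n SY SU t"
abbreviation "D t \<equiv> model_data K n Y U t"
abbreviation "events_of \<equiv> source_events M (SX 0) SW SZ X0 Xh0 W Z"
abbreviation "step \<equiv> filter_step K \<mu> p_trans p_obs"
abbreviation lik :: "nat \<Rightarrow> 'x \<times> 'x \<Rightarrow> (nat \<Rightarrow> 'y) \<Rightarrow> ennreal"
  where "lik t v y \<equiv> \<Prod>k\<in>{1..K}. p_obs t k (fst v) (y k)"

section \<open>Measurability with respect to past sources\<close>

lemma g_measurable: "t < T \<Longrightarrow> g t \<in> measurable (S t) (Pi\<^sub>M {1..K} (SU t))"
  using g by (simp add: control_strategies_def)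

text \<open>
  Applied with \<open>N\<close> generated by the sources up to time \<open>t\<close>, this makes the past independent of
  the later sources.
\<close>

lemma trajectory_measurable:
  assumes N: "space N = space M" and t: "t \<le> T"
    and init[measurable]: "X0 \<in> measurable N (SX 0)" "Xh0 \<in> measurable N (SX 0)"
    and WN: "\<And>s. s < t \<Longrightarrow> W s \<in> measurable N SW"
    and ZN: "\<And>s k. s \<le> t \<Longrightarrow> k \<in> {1..K} \<Longrightarrow> Z s k \<in> measurable N (SZ k)"
  shows "s \<le> t \<Longrightarrow> X s \<in> measurable N (SX s) \<and> Xh s \<in> measurable N (SX s) \<and>
    Y s \<in> measurable N (Pi\<^sub>M {1..K} SY) \<and> D s \<in> measurable N (S s)"
proof (induction s rule: less_induct)
  case (less s)
  \<comment> \<open>Controls before time \<open>s\<close> depend on earlier data only and come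
    first; they feed \<open>X s\<close>, then \<open>Y s\<close>, and finally \<open>D s\<close>,
    which holds no control at time \<open>s\<close>.\<close>
  have U': "U r \<in> measurable N (Pi\<^sub>M {1..K} (SU r))" if "r < s" for r
  proof -
    have r: "r < T" using that less.prems t by simp
    have "(\<lambda>\<omega>. g r (D r \<omega>)) \<in> measurable N (Pi\<^sub>M {1..K} (SU r))"
      using less.IH[OF that] that less.prems g_measurable[OF r] by (auto intro: measurable_compose)
    then show ?thesis
      by (subst measurable_cong[OF U_eq[OF r]]) (auto simp: N)
  qed
  have X': "X s \<in> measurable N (SX s) \<and> Xh s \<in> measurable N (SX s)"
  proof (cases s)
    case 0
    have "X 0 \<in> measurable N (SX 0)" by (subst measurable_cong[OF X_0]) (auto simp: N)
    moreover have "Xh 0 \<in> measurable N (SX 0)" by (subst measurable_cong[OF Xh_0]) (auto simp: N)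
    ultimately show ?thesis using 0 by simp
  next
    case (Suc r)
    have r: "r < T" "r < t" using Suc less.prems t by auto
    have [measurable]: "X r \<in> measurable N (SX r)" "Xh r \<in> measurable N (SX r)"
      "U r \<in> measurable N (Pi\<^sub>M {1..K} (SU r))" "W r \<in> measurable N SW"
      using less.IH[of r] less.prems U'[of r] WN[OF r(2)] Suc by auto
    have "(\<lambda>\<omega>. (X r \<omega>, U r \<omega>, W r \<omega>)) \<in> measurable N (SX r \<Otimes>\<^sub>M Pi\<^sub>M {1..K} (SU r) \<Otimes>\<^sub>M SW)"
      "(\<lambda>\<omega>. (Xh r \<omega>, U r \<omega>, W r \<omega>)) \<in> measurable N (SX r \<Otimes>\<^sub>M Pi\<^sub>M {1..K} (SU r) \<Otimes>\<^sub>M SW)"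
      by measurable
    from measurable_compose[OF this(1) f[OF r(1)]] measurable_compose[OF this(2) fh[OF r(1)]]
    have "(\<lambda>\<omega>. f r (X r \<omega>) (U r \<omega>) (W r \<omega>)) \<in> measurable N (SX (Suc r))"
      "(\<lambda>\<omega>. fh r (Xh r \<omega>) (U r \<omega>) (W r \<omega>)) \<in> measurable N (SX (Suc r))"
      by simp_all
    then show ?thesis
      unfolding Suc using measurable_cong[of N "X (Suc r)", OF X_Suc[OF r(1)]]
        measurable_cong[of N "Xh (Suc r)", OF Xh_Suc[OF r(1)]] N by simp
  qed
  then have [measurable]: "X s \<in> measurable N (SX s)" by simp
  have "(\<lambda>\<omega>. \<lambda>k\<in>{1..K}. h s k (X s \<omega>) (Z s k \<omega>)) \<in> measurable N (Pi\<^sub>M {1..K} SY)"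
  proof (rule measurable_restrict)
    fix k assume k: "k \<in> {1..K}"
    have s: "s \<le> T" using less.prems t by simp
    have [measurable]: "Z s k \<in> measurable N (SZ k)" by (rule ZN[OF less.prems k])
    show "(\<lambda>\<omega>. h s k (X s \<omega>) (Z s k \<omega>)) \<in> measurable N (SY k)"
      using measurable_compose[OF _ h[OF s k], of "\<lambda>\<omega>. (X s \<omega>, Z s k \<omega>)" N] by simp
  qed
  then have Y': "Y s \<in> measurable N (Pi\<^sub>M {1..K} SY)"
    using less.prems t by (subst measurable_cong[OF Y_eq[of s]]) (auto simp: N)
  have "Y r \<in> measurable N (Pi\<^sub>M {1..K} SY)" if "r \<le> s" for r
    using that Y' less.IH[of r] less.prems by (cases "r = s") auto
  then have "D s \<in> measurable N (S s)"
    by (intro measurable_model_data n U') auto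
  with X' Y' show ?case by simp
qed

text \<open>The bounds differ because the disturbance \<open>W t\<close> acts only on the state at
  the next time, whereas the noise at time \<open>t\<close> already enters
  \<open>Y t\<close>.\<close>

definition past :: "nat \<Rightarrow> source set"
  where "past t = {Initial} \<union> Disturbance ` {..<t} \<union> {Noise s k |s k. s \<le> t \<and> k \<in> {1..K}}"

lemma Int_stable_events_of: "Int_stable (events_of i)"
  by (cases i) (auto simp: Int_stable_def)

lemma events_of_subset: "events_of i \<subseteq> Pow (space M)"
proof -
  have closed: "space N = space M \<Longrightarrow> sets N \<subseteq> Pow (space M)" for N :: "'o measure"
    using sets.space_closed[of N] by simp
  show ?thesis by (cases i) (simp_all only: source_events.simps closed space_vimage_algebra)
qed

abbreviation "history I \<equiv> sigma (space M) (\<Union>i\<in>I. events_of i)"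

lemma sets_history: "sets (history I) = sigma_sets (space M) (\<Union>i\<in>I. events_of i)"
  using events_of_subset by (intro sets_measure_of) auto

lemma space_history: "space (history I) = space M"
  by (simp add: space_measure_of_conv)

lemma history_mono: "I \<subseteq> J \<Longrightarrow> q \<in> measurable (history I) N \<Longrightarrow> q \<in> measurable (history J) N"
  using measurable_mono[of N N "history I" "history J"]
  by (auto simp: sets_history space_history intro!: sigma_sets_mono' UN_mono)

lemma source_measurable:
  assumes i: "i \<in> I" and ev: "events_of i = sets (vimage_algebra (space M) q N)"
    and q: "q \<in> space M \<rightarrow> space N"
  shows "q \<in> measurable (history I) N"
proof -
  have "q \<in> measurable (vimage_algebra (space M) q N) N"
    by (rule measurable_vimage_algebra1[OF q])
  moreover have "sets (vimage_algebra (space M) q N) \<subseteq> sets (history I)"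
    unfolding sets_history ev[symmetric] using i by (auto intro: sigma_sets.Basic)
  ultimately show ?thesis
    using measurable_mono[of N N "vimage_algebra (space M) q N" "history I"]
    by (auto simp: space_history)
qed

lemma init_history: "Initial \<in> I \<Longrightarrow> (\<lambda>\<omega>. (X0 \<omega>, Xh0 \<omega>)) \<in> measurable (history I) (SX 0 \<Otimes>\<^sub>M SX 0)"
  using measurable_space[OF X0] measurable_space[OF Xh0]
  by (intro source_measurable[of Initial]) (auto simp: space_pair_measure)

lemma W_history: "Disturbance t \<in> I \<Longrightarrow> t < T \<Longrightarrow> W t \<in> measurable (history I) SW"
  using measurable_space[OF W[of t]] by (intro source_measurable[of "Disturbance t"]) auto

lemma Z_history:
  "Noise t k \<in> I \<Longrightarrow> t \<le> T \<Longrightarrow> k \<in> {1..K} \<Longrightarrow> Z t k \<in> measurable (history I) (SZ k)"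
  using measurable_space[OF Z[of t k]] by (intro source_measurable[of "Noise t k"]) auto

lemma past_measurable:
  assumes t: "t \<le> T"
  shows "(\<lambda>\<omega>. (X t \<omega>, Xh t \<omega>)) \<in> measurable (history (past t)) (SX t \<Otimes>\<^sub>M SX t)"
    and "D t \<in> measurable (history (past t)) (S t)"
proof -
  \<comment> \<open>\<open>X0\<close> and \<open>Xh0\<close> may be dependent and form one joint
    source; each is measurable by projection.\<close>
  have "(\<lambda>\<omega>. (X0 \<omega>, Xh0 \<omega>)) \<in> measurable (history (past t)) (SX 0 \<Otimes>\<^sub>M SX 0)"
    by (rule init_history) (simp add: past_def)
  from measurable_compose[OF this measurable_fst] measurable_compose[OF this measurable_snd]
  have "X0 \<in> measurable (history (past t)) (SX 0)" "Xh0 \<in> measurable (history (past t)) (SX 0)"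
    by simp_all
  from trajectory_measurable[OF space_history t this W_history Z_history, of t] t
  have "X t \<in> measurable (history (past t)) (SX t) \<and> Xh t \<in> measurable (history (past t)) (SX t) \<and>
      D t \<in> measurable (history (past t)) (S t)"
    by (auto simp: past_def)
  then show "(\<lambda>\<omega>. (X t \<omega>, Xh t \<omega>)) \<in> measurable (history (past t)) (SX t \<Otimes>\<^sub>M SX t)"
    and "D t \<in> measurable (history (past t)) (S t)" by auto
qed

lemma indep_history:
  assumes "I \<subseteq> sources K T" "J \<subseteq> sources K T" "I \<inter> J = {}"
    and "q \<in> measurable (history I) A" "r \<in> measurable (history J) B"
  shows "indep_pair A q B r"
  using indep_pair_collect_sigma[OF indep Int_stable_events_of assms] .

lemma noise_indep_vars: "t \<le> T \<Longrightarrow> indep_vars SZ (Z t) {1..K}"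
  unfolding indep_vars_def2
proof (intro conjI ballI)
  assume t: "t \<le> T"
  show "k \<in> {1..K} \<Longrightarrow> Z t k \<in> measurable M (SZ k)" for k by (rule Z[OF t])
  have "indep_sets (\<lambda>k. sigma_sets (space M) (\<Union>i\<in>{Noise t k}. events_of i)) {1..K}"
  proof (rule indep_sets_collect_sigma)
    show "indep_sets events_of (\<Union>k\<in>{1..K}. {Noise t k})"
      using t by (intro indep_sets_mono_index[OF _ indep]) (auto simp: sources_def)
    show "disjoint_family_on (\<lambda>k. {Noise t k}) {1..K}"
      by (auto simp: disjoint_family_on_def)
  qed (rule Int_stable_events_of)
  then show "indep_sets (\<lambda>k. {Z t k -` A \<inter> space M |A. A \<in> sets (SZ k)}) {1..K}"
  proof (rule indep_sets_mono_sets)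
    fix k assume k: "k \<in> {1..K}"
    have "Z t k \<in> measurable (history {Noise t k}) (SZ k)"
      by (rule Z_history[OF _ t k]) simp
    from measurable_sets[OF this]
    show "{Z t k -` A \<inter> space M |A. A \<in> sets (SZ k)} \<subseteq> sigma_sets (space M) (\<Union>i\<in>{Noise t k}. events_of i)"
      unfolding sets_history space_history by blast
  qed
qed

section \<open>Observation densities and the measurement step\<close>

lemma measurable_\<mu>: "t \<le> T \<Longrightarrow> measurable (\<mu> t) N = measurable (SX t \<Otimes>\<^sub>M SX t) N"
  by (intro measurable_cong_sets sets_\<mu>) auto

lemma measurable_into_\<mu>: "t \<le> T \<Longrightarrow> measurable N (\<mu> t) = measurable N (SX t \<Otimes>\<^sub>M SX t)"
  by (intro measurable_cong_sets sets_\<mu>) auto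

lemma lik_measurable:
  assumes t: "t \<le> T"
  shows "(\<lambda>(v, y). lik t v y) \<in> borel_measurable (\<mu> t \<Otimes>\<^sub>M Pi\<^sub>M {1..K} SY)"
proof -
  have [measurable]: "fst \<in> measurable (\<mu> t) (SX t)" by (simp add: measurable_\<mu>[OF t])
  have "(\<lambda>z. p_obs t k (fst (fst z)) (snd z k)) \<in> borel_measurable (\<mu> t \<Otimes>\<^sub>M Pi\<^sub>M {1..K} SY)"
    if k[measurable]: "k \<in> {1..K}" for k
  proof -
    have "(\<lambda>z. (fst (fst z), snd z k)) \<in> measurable (\<mu> t \<Otimes>\<^sub>M Pi\<^sub>M {1..K} SY) (SX t \<Otimes>\<^sub>M SY k)"
      by measurable
    from measurable_compose[OF this p_obs[OF t k]] show ?thesis by simp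
  qed
  then show ?thesis unfolding case_prod_beta by (rule borel_measurable_prod_ennreal)
qed

lemma sigma_finite_SY: "sigma_finite_measure (Pi\<^sub>M {1..K} SY)"
proof -
  define Q where "Q k = (if k \<in> {1..K} then SY k else count_space {})" for k
  have "sigma_finite_measure (Q k)" for k
    by (simp add: Q_def SY sigma_finite_measure_count_space_finite)
  then interpret Q: product_sigma_finite Q by (simp add: product_sigma_finite_def)
  have "Pi\<^sub>M {1..K} Q = Pi\<^sub>M {1..K} SY" by (rule PiM_cong) (auto simp: Q_def)
  then show ?thesis using Q.sigma_finite[of "{1..K}"] by simp
qed

text \<open>For a frozen state the components are functions of independent noises, so their
  densities multiply; the finitely many exceptional null sets, one per subsystem, unite to a null
  set.\<close>

lemma obs_distributed:
  assumes t: "t \<le> T"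
  shows "AE v in \<mu> t. distributed M (Pi\<^sub>M {1..K} SY)
    (\<lambda>\<omega>. \<lambda>k\<in>{1..K}. h t k (fst v) (Z t k \<omega>)) (lik t v)"
proof -
  have "AE v in \<mu> t. \<forall>k\<in>{1..K}. distributed M (SY k) (\<lambda>\<omega>. h t k (fst v) (Z t k \<omega>)) (p_obs t k (fst v))"
  proof (rule AE_finite_allI)
    fix k assume "k \<in> {1..K}"
    from obs[OF t this]
    show "AE v in \<mu> t. distributed M (SY k) (\<lambda>\<omega>. h t k (fst v) (Z t k \<omega>)) (p_obs t k (fst v))"
      by (simp add: case_prod_beta)
  qed simp
  then show ?thesis
  proof (rule AE_mp, intro AE_I2 impI)
    fix v assume elim: "v \<in> space (\<mu> t)"
      "\<forall>k\<in>{1..K}. distributed M (SY k) (\<lambda>\<omega>. h t k (fst v) (Z t k \<omega>)) (p_obs t k (fst v))"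
    have "space (\<mu> t) = space (SX t) \<times> space (SX t)"
      using sets_eq_imp_space_eq[OF sets_\<mu>[OF t]] by (simp only: space_pair_measure)
    with elim(1) have v: "fst v \<in> space (SX t)" by (simp only: mem_Times_iff)
    have ind: "indep_vars SY (\<lambda>k \<omega>. h t k (fst v) (Z t k \<omega>)) {1..K}"
    proof (rule indep_vars_compose2[OF noise_indep_vars[OF t]])
      show "h t k (fst v) \<in> measurable (SZ k) (SY k)" if "k \<in> {1..K}" for k
        using measurable_Pair2[OF h[OF t that] v] by simp
    qed
    show "distributed M (Pi\<^sub>M {1..K} SY)
        (\<lambda>\<omega>. \<lambda>k\<in>{1..K}. h t k (fst v) (Z t k \<omega>)) (lik t v)"
      by (rule distributed_PiM_indep_vars[OF finite_atLeastAtMost SY ind, where l="\<lambda>k. p_obs t k (fst v)"])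
        (assumption, rule elim(2)[rule_format])
  qed
qed

lemma filter_step_measurable:
  assumes t: "t < T"
    and \<rho>[measurable]: "(\<lambda>(d, v). \<rho> d v) \<in> borel_measurable (N \<Otimes>\<^sub>M \<mu> t)"
    and y[measurable]: "y \<in> measurable N (Pi\<^sub>M {1..K} SY)"
    and u[measurable]: "u \<in> measurable N (Pi\<^sub>M {1..K} (SU t))"
  shows "(\<lambda>(d, v). step t (\<rho> d) (y d) (u d) v) \<in> borel_measurable (N \<Otimes>\<^sub>M \<mu> (Suc t))"
proof -
  interpret \<mu>t: sigma_finite_measure "\<mu> t" using \<mu> t by simp
  interpret \<mu>t': sigma_finite_measure "\<mu> (Suc t)" using \<mu> t by simp
  define P where "P = (\<lambda>(v, u, v'). p_trans t v u v')"
  have [measurable]: "P \<in> borel_measurable (\<mu> t \<Otimes>\<^sub>M Pi\<^sub>M {1..K} (SU t) \<Otimes>\<^sub>M \<mu> (Suc t))"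
    unfolding P_def by (rule p_trans[OF t])
  have P: "p_trans t v u v' = P (v, u, v')" for v u v' by (simp add: P_def)
  define L where "L = (\<lambda>(v, y). lik (Suc t) v y)"
  have [measurable]: "L \<in> borel_measurable (\<mu> (Suc t) \<Otimes>\<^sub>M Pi\<^sub>M {1..K} SY)"
    unfolding L_def using lik_measurable[of "Suc t"] t by simp
  have L: "lik (Suc t) v y = L (v, y)" for v y by (simp add: L_def)
  show ?thesis
    unfolding filter_step_def bayes_update_def predict_def L P by measurable
qed

text \<open>One measurement step serves the initial time and all later ones. Prior data
  \<open>C\<close> and state \<open>V\<close> may depend on any sources \<open>I\<close> that omit
  the noises at time \<open>t\<close>, which makes the noise vector independent of them.\<close>

lemma observation_update:
  assumes t: "t \<le> T" and p: "cond_density M A C (\<mu> t) V p"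
    and C: "C \<in> measurable (history I) A" and V: "V \<in> measurable (history I) (\<mu> t)"
    and I: "I \<subseteq> sources K T" "\<And>k. Noise t k \<notin> I"
  shows "cond_density M (A \<Otimes>\<^sub>M Pi\<^sub>M {1..K} SY)
    (\<lambda>\<omega>. (C \<omega>, \<lambda>k\<in>{1..K}. h t k (fst (V \<omega>)) (Z t k \<omega>))) (\<mu> t) V
    (\<lambda>(d, y). bayes_update (\<mu> t) (lik t) (p d) y)"
proof -
  let ?J = "Noise t ` {1..K}"
  define H where "H = (\<lambda>(v :: 'x \<times> 'x, z :: nat \<Rightarrow> 'z). \<lambda>k\<in>{1..K}. h t k (fst v) (z k))"
  have ind: "indep_pair (A \<Otimes>\<^sub>M \<mu> t) (\<lambda>\<omega>. (C \<omega>, V \<omega>)) (Pi\<^sub>M {1..K} SZ) (\<lambda>\<omega>. \<lambda>k\<in>{1..K}. Z t k \<omega>)"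
  proof (rule indep_history)
    show "I \<subseteq> sources K T" "?J \<subseteq> sources K T" "I \<inter> ?J = {}"
      using I t by (auto simp: sources_def)
    show "(\<lambda>\<omega>. (C \<omega>, V \<omega>)) \<in> measurable (history I) (A \<Otimes>\<^sub>M \<mu> t)" using C V by measurable
    show "(\<lambda>\<omega>. \<lambda>k\<in>{1..K}. Z t k \<omega>) \<in> measurable (history ?J) (Pi\<^sub>M {1..K} SZ)"
      using t by (intro measurable_restrict Z_history) auto
  qed
  have H_meas: "H \<in> measurable (\<mu> t \<Otimes>\<^sub>M Pi\<^sub>M {1..K} SZ) (Pi\<^sub>M {1..K} SY)"
    unfolding H_def case_prod_beta
  proof (rule measurable_restrict)
    fix k assume k[measurable]: "k \<in> {1..K}"
    have [measurable]: "fst \<in> measurable (\<mu> t) (SX t)" by (simp add: measurable_\<mu>[OF t])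
    have "(\<lambda>z. (fst (fst z), snd z k)) \<in> measurable (\<mu> t \<Otimes>\<^sub>M Pi\<^sub>M {1..K} SZ) (SX t \<Otimes>\<^sub>M SZ k)"
      by measurable
    from measurable_compose[OF this h[OF t k]]
    show "(\<lambda>z. h t k (fst (fst z)) (snd z k)) \<in> measurable (\<mu> t \<Otimes>\<^sub>M Pi\<^sub>M {1..K} SZ) (SY k)" by simp
  qed
  have H_eq: "H (v, \<lambda>k\<in>{1..K}. Z t k \<omega>) = (\<lambda>k\<in>{1..K}. h t k (fst v) (Z t k \<omega>))" for v \<omega>
    unfolding H_def prod.case by (rule restrict_cong) auto
  have "AE v in \<mu> t. distributed M (Pi\<^sub>M {1..K} SY) (\<lambda>\<omega>. H (v, \<lambda>k\<in>{1..K}. Z t k \<omega>)) (lik t v)"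
    unfolding H_eq by (rule obs_distributed[OF t])
  from cond_density_bayes_update[OF \<mu>[OF t] sigma_finite_SY p ind H_meas lik_measurable[OF t] this]
  show ?thesis unfolding H_eq .
qed

section \<open>Recovering trajectories and earlier data\<close>

lemma Y_extensional: "t \<le> T \<Longrightarrow> \<omega> \<in> space M \<Longrightarrow> Y t \<omega> \<in> extensional {1..K}"
  by (simp add: Y_eq)

lemma U_extensional: "t < T \<Longrightarrow> \<omega> \<in> space M \<Longrightarrow> U t \<omega> \<in> extensional {1..K}"
  using measurable_space[OF g_measurable[of t], of "D t \<omega>"]
    measurable_space[OF past_measurable(2)[of t], of \<omega>]
  by (simp add: U_eq space_history space_PiM PiE_iff)

lemma data_Y_D: "s \<le> t \<Longrightarrow> t \<le> T \<Longrightarrow> \<omega> \<in> space M \<Longrightarrow> data_Y K n t (D t \<omega>) s = Y s \<omega>"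
  by (rule data_Y_model_data) (simp, rule Y_extensional, simp_all)

lemma data_U_D: "s < t \<Longrightarrow> t \<le> T \<Longrightarrow> \<omega> \<in> space M \<Longrightarrow> data_U K n t (D t \<omega>) s = U s \<omega>"
  by (rule data_U_model_data) (simp, rule U_extensional, simp_all)

lemma prefix_data_D:
  "Suc t \<le> T \<Longrightarrow> \<omega> \<in> space M \<Longrightarrow> prefix_data K n t (D (Suc t) \<omega>) = D t \<omega>"
  unfolding prefix_data_def by (intro model_data_cong n) (simp_all add: data_Y_D data_U_D)

lemma prefix_data_measurable: "prefix_data K n t \<in> measurable (S (Suc t)) (S t)"
  unfolding prefix_data_def
  by (intro measurable_model_data n measurable_data_Y measurable_data_U) auto

section \<open>Information states at the initial and at the next time\<close>

lemma past_sources: "t \<le> T \<Longrightarrow> past t \<subseteq> sources K T"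
  by (auto simp: past_def sources_def)

text \<open>Before the first observation the data are trivial and the density is
  \<open>p_init\<close>, so a single Bayes step remains. The formula reads \<open>Y 0\<close> off
  the data and is therefore the same for all strategies.\<close>

lemma information_state_0:
  "information_state M K n SY SU \<mu> X Xh Y U 0
    (\<lambda>d. bayes_update (\<mu> 0) (lik 0) p_init (data_Y K n 0 d 0))"
  unfolding information_state_def
proof (rule cond_density_transport)
  let ?V = "\<lambda>\<omega>. (X0 \<omega>, Xh0 \<omega>)"
  \<comment> \<open>Since \<open>1 \<le> n\<close>, no control is recorded at time \<open>0\<close>,
    and the trajectory \<open>undefined\<close> is never read.\<close>
  let ?\<Phi> = "\<lambda>(_ :: unit, y). model_data K n (\<lambda>_ y. y) (\<lambda>_ _. undefined) 0 y"
  show "sigma_finite_measure (\<mu> 0)" by (rule \<mu>) simp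
  show "cond_density M (count_space {()} \<Otimes>\<^sub>M Pi\<^sub>M {1..K} SY)
      (\<lambda>\<omega>. ((), \<lambda>k\<in>{1..K}. h 0 k (fst (?V \<omega>)) (Z 0 k \<omega>))) (\<mu> 0) ?V
      (\<lambda>(d, y). bayes_update (\<mu> 0) (lik 0) p_init y)"
  proof (rule observation_update)
    show "cond_density M (count_space {()}) (\<lambda>_. ()) (\<mu> 0) ?V (\<lambda>_. p_init)"
      by (rule cond_density_trivial[OF _ p_init]) (simp add: \<mu>)
    show "?V \<in> measurable (history {Initial}) (\<mu> 0)"
      unfolding measurable_into_\<mu>[OF le0] by (rule init_history) simp
  qed (auto simp: sources_def)
  have "(\<lambda>y. model_data K n (\<lambda>_ y. y) (\<lambda>_ _. undefined) 0 y) \<in> measurable (Pi\<^sub>M {1..K} SY) (S 0)"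
    by (rule measurable_model_data) (use n in auto)
  then show "?\<Phi> \<in> measurable (count_space {()} \<Otimes>\<^sub>M Pi\<^sub>M {1..K} SY) (S 0)"
    unfolding case_prod_beta by (rule measurable_compose[OF measurable_snd])
  fix \<omega> assume \<omega>: "\<omega> \<in> space M"
  show "D 0 \<omega> = ?\<Phi> ((), \<lambda>k\<in>{1..K}. h 0 k (fst (?V \<omega>)) (Z 0 k \<omega>))"
    unfolding prod.case by (rule model_data_cong[OF n]) (simp_all add: Y_eq X_0 \<omega>)
  show "(X 0 \<omega>, Xh 0 \<omega>) = ?V \<omega>" by (simp add: X_0 Xh_0 \<omega>)
  show "bayes_update (\<mu> 0) (lik 0) p_init (data_Y K n 0 (D 0 \<omega>) 0) =
      (case ((), \<lambda>k\<in>{1..K}. h 0 k (fst (?V \<omega>)) (Z 0 k \<omega>)) of (d, y) \<Rightarrow> bayes_update (\<mu> 0) (lik 0) p_init y)"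
    by (simp add: data_Y_D Y_eq X_0 \<omega>)
next
  interpret \<mu>0: sigma_finite_measure "\<mu> 0" using \<mu> by simp
  define L where "L = (\<lambda>(v, y). lik 0 v y)"
  have [measurable]: "L \<in> borel_measurable (\<mu> 0 \<Otimes>\<^sub>M Pi\<^sub>M {1..K} SY)"
    unfolding L_def using lik_measurable[of 0] by simp
  have L: "lik 0 v y = L (v, y)" for v y by (simp add: L_def)
  have [measurable]: "p_init \<in> borel_measurable (\<mu> 0)" using p_init by (simp add: distributed_def)
  have [measurable]: "(\<lambda>d. data_Y K n 0 d 0) \<in> measurable (S 0) (Pi\<^sub>M {1..K} SY)"
    by (rule measurable_data_Y) simp
  show "(\<lambda>(d, v). bayes_update (\<mu> 0) (lik 0) p_init (data_Y K n 0 d 0) v) \<in> borel_measurable (S 0 \<Otimes>\<^sub>M \<mu> 0)"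
    unfolding bayes_update_def L by measurable
qed

text \<open>Prediction conditions on \<open>D t\<close>, the measurement step on the pair of
  \<open>D t\<close> and \<open>Y (Suc t)\<close>, and transport turns this pair into
  \<open>D (Suc t)\<close>. The resulting formula evaluates \<open>p\<close> at the data truncated
  to time \<open>t\<close> and calls no control law.\<close>

lemma information_state_Suc:
  assumes t: "t < T" and p: "information_state M K n SY SU \<mu> X Xh Y U t p"
  shows "information_state M K n SY SU \<mu> X Xh Y U (Suc t)
    (\<lambda>d. step t (p (prefix_data K n t d)) (data_Y K n (Suc t) d (Suc t)) (data_U K n (Suc t) d t))"
  unfolding information_state_def
proof (rule cond_density_transport)
  have t': "t \<le> T" "Suc t \<le> T" using t by auto
  let ?V = "\<lambda>\<omega>. (X t \<omega>, Xh t \<omega>)"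
  \<comment> \<open>The state at time \<open>t + 1\<close> also uses \<open>W t\<close>; the noises
    at time \<open>t + 1\<close> remain outside this set.\<close>
  let ?I = "insert (Disturbance t) (past t)"
  note [measurable] = g_measurable[OF t]
  have p': "cond_density M (S t) (D t) (\<mu> t) ?V p" using p by (simp add: information_state_def)
  \<comment> \<open>Given \<open>D t = d\<close> the control is the constant \<open>g t d\<close>,
    so the transition density is taken at that value.\<close>
  define G where "G = (\<lambda>(d, v, w). (f t (fst v) (g t d) w, fh t (snd v) (g t d) w))"
  define \<tau> where "\<tau> = (\<lambda>(d, v, v'). p_trans t v (g t d) v')"
  define V' where "V' = (\<lambda>\<omega>. G (D t \<omega>, ?V \<omega>, W t \<omega>))"
  have V'_eq: "V' \<omega> = (X (Suc t) \<omega>, Xh (Suc t) \<omega>)" if "\<omega> \<in> space M" for \<omega>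
    using that t by (simp add: V'_def G_def X_Suc Xh_Suc U_eq)
  have [measurable]: "fst \<in> measurable (\<mu> t) (SX t)" "snd \<in> measurable (\<mu> t) (SX t)"
    by (simp_all add: measurable_\<mu>[OF t'(1)])
  have G_meas: "G \<in> measurable (S t \<Otimes>\<^sub>M \<mu> t \<Otimes>\<^sub>M SW) (\<mu> (Suc t))"
  proof -
    have "(\<lambda>z. (fst (fst (snd z)), g t (fst z), snd (snd z))) \<in> measurable (S t \<Otimes>\<^sub>M \<mu> t \<Otimes>\<^sub>M SW) (SX t \<Otimes>\<^sub>M Pi\<^sub>M {1..K} (SU t) \<Otimes>\<^sub>M SW)"
      "(\<lambda>z. (snd (fst (snd z)), g t (fst z), snd (snd z))) \<in> measurable (S t \<Otimes>\<^sub>M \<mu> t \<Otimes>\<^sub>M SW) (SX t \<Otimes>\<^sub>M Pi\<^sub>M {1..K} (SU t) \<Otimes>\<^sub>M SW)"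
      by measurable
    from measurable_Pair[OF measurable_compose[OF this(1) f[OF t]] measurable_compose[OF this(2) fh[OF t]]]
    show ?thesis
      unfolding measurable_into_\<mu>[OF t'(2)] G_def case_prod_beta by simp
  qed
  have \<tau>_meas: "\<tau> \<in> borel_measurable (S t \<Otimes>\<^sub>M \<mu> t \<Otimes>\<^sub>M \<mu> (Suc t))"
  proof -
    have "(\<lambda>z. (fst (snd z), g t (fst z), snd (snd z))) \<in>
        measurable (S t \<Otimes>\<^sub>M \<mu> t \<Otimes>\<^sub>M \<mu> (Suc t)) (\<mu> t \<Otimes>\<^sub>M Pi\<^sub>M {1..K} (SU t) \<Otimes>\<^sub>M \<mu> (Suc t))"
      by measurable
    from measurable_compose[OF this p_trans[OF t]] show ?thesis
      unfolding \<tau>_def case_prod_beta by simp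
  qed
  have D_hist: "D t \<in> measurable (history (past t)) (S t)" by (rule past_measurable(2)[OF t'(1)])
  have V_hist: "?V \<in> measurable (history (past t)) (\<mu> t)"
    unfolding measurable_into_\<mu>[OF t'(1)] by (rule past_measurable(1)[OF t'(1)])
  have W_hist: "W t \<in> measurable (history {Disturbance t}) SW" by (rule W_history) (simp_all add: t)
  have DV_hist: "(\<lambda>\<omega>. (D t \<omega>, ?V \<omega>)) \<in> measurable (history (past t)) (S t \<Otimes>\<^sub>M \<mu> t)"
    by (rule measurable_Pair[OF D_hist V_hist])
  \<comment> \<open>\<open>past t\<close> contains only disturbances strictly before
    \<open>t\<close>, hence not \<open>Disturbance t\<close>.\<close>
  have "indep_pair (S t \<Otimes>\<^sub>M \<mu> t) (\<lambda>\<omega>. (D t \<omega>, ?V \<omega>)) SW (W t)"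
    by (rule indep_history[OF past_sources[OF t'(1)] _ _ DV_hist W_hist])
      (use t in \<open>auto simp: past_def sources_def\<close>)
  from cond_density_predict[OF \<mu>[OF t'(1)] \<mu>[OF t'(2)] p' this G_meas \<tau>_meas]
  have pred: "cond_density M (S t) (D t) (\<mu> (Suc t)) V'
      (\<lambda>d. predict (\<mu> t) (\<lambda>v v'. \<tau> (d, v, v')) (p d))"
    unfolding V'_def
  proof this
    fix d assume "d \<in> space (S t)"
    then have "g t d \<in> space (Pi\<^sub>M {1..K} (SU t))" by (rule measurable_space[OF g_measurable[OF t]])
    from trans[OF t this]
    show "AE v in \<mu> t. distributed M (\<mu> (Suc t)) (\<lambda>\<omega>. G (d, v, W t \<omega>)) (\<lambda>v'. \<tau> (d, v, v'))"
      by (simp add: G_def \<tau>_def case_prod_beta)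
  qed
  show "cond_density M (S t \<Otimes>\<^sub>M Pi\<^sub>M {1..K} SY)
      (\<lambda>\<omega>. (D t \<omega>, \<lambda>k\<in>{1..K}. h (Suc t) k (fst (V' \<omega>)) (Z (Suc t) k \<omega>))) (\<mu> (Suc t)) V'
      (\<lambda>(d, y). bayes_update (\<mu> (Suc t)) (lik (Suc t)) (predict (\<mu> t) (\<lambda>v v'. \<tau> (d, v, v')) (p d)) y)"
  proof (rule observation_update[OF t'(2) pred])
    show D_I: "D t \<in> measurable (history ?I) (S t)" by (rule history_mono[OF _ D_hist]) auto
    have "?V \<in> measurable (history ?I) (\<mu> t)" by (rule history_mono[OF _ V_hist]) auto
    moreover have "W t \<in> measurable (history ?I) SW" by (rule history_mono[OF _ W_hist]) auto
    ultimately have "(\<lambda>\<omega>. (D t \<omega>, ?V \<omega>, W t \<omega>)) \<in> measurable (history ?I) (S t \<Otimes>\<^sub>M \<mu> t \<Otimes>\<^sub>M SW)"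
      by (intro measurable_Pair D_I)
    from measurable_compose[OF this G_meas] show "V' \<in> measurable (history ?I) (\<mu> (Suc t))"
      by (simp add: V'_def)
    show "?I \<subseteq> sources K T" using past_sources[OF t'(1)] t by (auto simp: sources_def)
    show "Noise (Suc t) k \<notin> ?I" for k by (auto simp: past_def)
  qed
  \<comment> \<open>Older entries are read off \<open>d\<close>. The new ones are the observation
    \<open>y\<close> and the control, which has to be recomputed as \<open>g t d\<close> because the
    data at time \<open>t\<close> do not contain it.\<close>
  define \<Phi> where "\<Phi> = model_data K n
    (\<lambda>s (d, y). if s \<le> t then data_Y K n t d s else y) (\<lambda>s (d, y). if s < t then data_U K n t d s else g t d) (Suc t)"
  show "\<Phi> \<in> measurable (S t \<Otimes>\<^sub>M Pi\<^sub>M {1..K} SY) (S (Suc t))"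
    unfolding \<Phi>_def
  proof (rule measurable_model_data[OF n])
    show "(\<lambda>(d, y). if s \<le> t then data_Y K n t d s else y) \<in> measurable (S t \<Otimes>\<^sub>M Pi\<^sub>M {1..K} SY) (Pi\<^sub>M {1..K} SY)" for s
      unfolding case_prod_beta using measurable_compose[OF measurable_fst measurable_data_Y[of s t K n SY SU]]
      by (cases "s \<le> t") auto
    show "(\<lambda>(d, y). if s < t then data_U K n t d s else g t d) \<in> measurable (S t \<Otimes>\<^sub>M Pi\<^sub>M {1..K} SY) (Pi\<^sub>M {1..K} (SU s))"
      if "s < Suc t" for s
      unfolding case_prod_beta using measurable_compose[OF measurable_fst measurable_data_U[of s t K n SY SU]]
        measurable_compose[OF measurable_fst g_measurable[OF t]] that
      by (cases "s < t") (auto simp: less_Suc_eq)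
  qed
  show "sigma_finite_measure (\<mu> (Suc t))" by (rule \<mu>[OF t'(2)])
  fix \<omega> assume \<omega>: "\<omega> \<in> space M"
  have Y': "(\<lambda>k\<in>{1..K}. h (Suc t) k (fst (V' \<omega>)) (Z (Suc t) k \<omega>)) = Y (Suc t) \<omega>"
    using \<omega> t by (simp add: V'_eq Y_eq)
  show "D (Suc t) \<omega> = \<Phi> (D t \<omega>, \<lambda>k\<in>{1..K}. h (Suc t) k (fst (V' \<omega>)) (Z (Suc t) k \<omega>))"
    unfolding Y' \<Phi>_def
  proof (rule model_data_cong[OF n])
    show "Y s \<omega> = (case (D t \<omega>, Y (Suc t) \<omega>) of (d, y) \<Rightarrow> if s \<le> t then data_Y K n t d s else y)"
      if "s \<le> Suc t" for s
      using that t \<omega> by (auto simp: data_Y_D le_Suc_eq)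
    show "U s \<omega> = (case (D t \<omega>, Y (Suc t) \<omega>) of (d, y) \<Rightarrow> if s < t then data_U K n t d s else g t d)"
      if "s < Suc t" for s
      using that t \<omega> by (auto simp: data_U_D less_Suc_eq U_eq)
  qed
  show "(X (Suc t) \<omega>, Xh (Suc t) \<omega>) = V' \<omega>" by (simp add: V'_eq \<omega>)
  \<comment> \<open>Here \<open>g\<close> is eliminated: \<open>data_U\<close> returns
    \<open>U t \<omega>\<close>, which equals \<open>g t (D t \<omega>)\<close>, so the transition
    density at \<open>g t d\<close> is the one at the recorded control.\<close>
  show "step t (p (prefix_data K n t (D (Suc t) \<omega>))) (data_Y K n (Suc t) (D (Suc t) \<omega>) (Suc t))
      (data_U K n (Suc t) (D (Suc t) \<omega>) t) =
    (case (D t \<omega>, \<lambda>k\<in>{1..K}. h (Suc t) k (fst (V' \<omega>)) (Z (Suc t) k \<omega>)) of (d, y) \<Rightarrow>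
      bayes_update (\<mu> (Suc t)) (lik (Suc t)) (predict (\<mu> t) (\<lambda>v v'. \<tau> (d, v, v')) (p d)) y)"
    unfolding Y' using \<omega> t'
    by (simp add: prefix_data_D data_Y_D data_U_D filter_step_def \<tau>_def U_eq)
next
  note [measurable] = prefix_data_measurable
  have [measurable]: "(\<lambda>(d, v). p d v) \<in> borel_measurable (S t \<Otimes>\<^sub>M \<mu> t)"
    using p by (simp add: information_state_def cond_density_def)
  show "(\<lambda>(d, v). step t (p (prefix_data K n t d)) (data_Y K n (Suc t) d (Suc t)) (data_U K n (Suc t) d t) v)
      \<in> borel_measurable (S (Suc t) \<Otimes>\<^sub>M \<mu> (Suc t))"
  proof (rule filter_step_measurable[OF t])
    show "(\<lambda>(d, v). p (prefix_data K n t d) v) \<in> borel_measurable (S (Suc t) \<Otimes>\<^sub>M \<mu> t)" by measurable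
    show "(\<lambda>d. data_Y K n (Suc t) d (Suc t)) \<in> measurable (S (Suc t)) (Pi\<^sub>M {1..K} SY)"
      by (rule measurable_data_Y) simp
    show "(\<lambda>d. data_U K n (Suc t) d t) \<in> measurable (S (Suc t)) (Pi\<^sub>M {1..K} (SU t))"
      by (rule measurable_data_U) simp
  qed
qed

end

section \<open>One version for all strategies, and the recursion for arbitrary versions\<close>

theorem theorem1:
  fixes M :: "'o measure" and K T n :: nat
    and SX :: "nat \<Rightarrow> 'x measure" and SU :: "nat \<Rightarrow> nat \<Rightarrow> 'u measure"
    and SW :: "'w measure" and SY :: "nat \<Rightarrow> 'y measure" and SZ :: "nat \<Rightarrow> 'z measure"
    and f fh :: "nat \<Rightarrow> 'x \<Rightarrow> (nat \<Rightarrow> 'u) \<Rightarrow> 'w \<Rightarrow> 'x"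
    and h :: "nat \<Rightarrow> nat \<Rightarrow> 'x \<Rightarrow> 'z \<Rightarrow> 'y"
    and X0 Xh0 :: "'o \<Rightarrow> 'x" and W :: "nat \<Rightarrow> 'o \<Rightarrow> 'w" and Z :: "nat \<Rightarrow> nat \<Rightarrow> 'o \<Rightarrow> 'z"
    and \<mu> :: "nat \<Rightarrow> ('x \<times> 'x) measure"
    and p_init :: "'x \<times> 'x \<Rightarrow> ennreal"
    and p_trans :: "nat \<Rightarrow> 'x \<times> 'x \<Rightarrow> (nat \<Rightarrow> 'u) \<Rightarrow> 'x \<times> 'x \<Rightarrow> ennreal"
    and p_obs :: "nat \<Rightarrow> nat \<Rightarrow> 'x \<Rightarrow> 'y \<Rightarrow> ennreal"
    and X Xh :: "(nat \<Rightarrow> ('y, 'u) data \<Rightarrow> nat \<Rightarrow> 'u) \<Rightarrow> nat \<Rightarrow> 'o \<Rightarrow> 'x"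
    and Y :: "(nat \<Rightarrow> ('y, 'u) data \<Rightarrow> nat \<Rightarrow> 'u) \<Rightarrow> nat \<Rightarrow> 'o \<Rightarrow> nat \<Rightarrow> 'y"
    and U :: "(nat \<Rightarrow> ('y, 'u) data \<Rightarrow> nat \<Rightarrow> 'u) \<Rightarrow> nat \<Rightarrow> 'o \<Rightarrow> nat \<Rightarrow> 'u"
    and \<G> :: "(nat \<Rightarrow> ('y, 'u) data \<Rightarrow> nat \<Rightarrow> 'u) set"
  assumes "prob_space M" and "1 \<le> n" and "\<G> = control_strategies K T n SY SU"
    \<comment> \<open>measurability of the model\<close>
    and "\<And>t. t < T \<Longrightarrow> (\<lambda>(x, u, w). f t x u w)
          \<in> measurable (SX t \<Otimes>\<^sub>M Pi\<^sub>M {1..K} (SU t) \<Otimes>\<^sub>M SW) (SX (Suc t))"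
    and "\<And>t. t < T \<Longrightarrow> (\<lambda>(x, u, w). fh t x u w)
          \<in> measurable (SX t \<Otimes>\<^sub>M Pi\<^sub>M {1..K} (SU t) \<Otimes>\<^sub>M SW) (SX (Suc t))"
    and "\<And>t k. t \<le> T \<Longrightarrow> k \<in> {1..K} \<Longrightarrow> (\<lambda>(x, z). h t k x z)
          \<in> measurable (SX t \<Otimes>\<^sub>M SZ k) (SY k)"
    \<comment> \<open>primitive random variables\<close>
    and "X0 \<in> measurable M (SX 0)" and "Xh0 \<in> measurable M (SX 0)"
    and "\<And>t. t < T \<Longrightarrow> W t \<in> measurable M SW"
    and "\<And>t k. t \<le> T \<Longrightarrow> k \<in> {1..K} \<Longrightarrow> Z t k \<in> measurable M (SZ k)"
    and "prob_space.indep_sets M (source_events M (SX 0) SW SZ X0 Xh0 W Z) (sources K T)"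
    \<comment> \<open>existence of densities with respect to the reference measures \<open>\<mu> t\<close> and \<open>SY k\<close>\<close>
    and "\<And>t. t \<le> T \<Longrightarrow> sigma_finite_measure (\<mu> t)"
    and "\<And>t. t \<le> T \<Longrightarrow> sets (\<mu> t) = sets (SX t \<Otimes>\<^sub>M SX t)"
    and "\<And>k. k \<in> {1..K} \<Longrightarrow> sigma_finite_measure (SY k)"
    and "distributed M (\<mu> 0) (\<lambda>\<omega>. (X0 \<omega>, Xh0 \<omega>)) p_init"
    and "\<And>t. t < T \<Longrightarrow> (\<lambda>(x, u, x'). p_trans t x u x')
          \<in> borel_measurable (\<mu> t \<Otimes>\<^sub>M Pi\<^sub>M {1..K} (SU t) \<Otimes>\<^sub>M \<mu> (Suc t))"
    and "\<And>t u. t < T \<Longrightarrow> u \<in> space (Pi\<^sub>M {1..K} (SU t)) \<Longrightarrow>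
          AE (x, xh) in \<mu> t. distributed M (\<mu> (Suc t))
            (\<lambda>\<omega>. (f t x u (W t \<omega>), fh t xh u (W t \<omega>))) (p_trans t (x, xh) u)"
    and "\<And>t k. t \<le> T \<Longrightarrow> k \<in> {1..K} \<Longrightarrow> (\<lambda>(x, y). p_obs t k x y)
          \<in> borel_measurable (SX t \<Otimes>\<^sub>M SY k)"
    and "\<And>t k. t \<le> T \<Longrightarrow> k \<in> {1..K} \<Longrightarrow>
          AE (x, xh) in \<mu> t. distributed M (SY k) (\<lambda>\<omega>. h t k x (Z t k \<omega>)) (p_obs t k x)"
    \<comment> \<open>the two systems under the strategy \<open>g\<close>\<close>
    and "\<And>g \<omega>. g \<in> \<G> \<Longrightarrow> \<omega> \<in> space M \<Longrightarrow> X g 0 \<omega> = X0 \<omega>"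
    and "\<And>g \<omega>. g \<in> \<G> \<Longrightarrow> \<omega> \<in> space M \<Longrightarrow> Xh g 0 \<omega> = Xh0 \<omega>"
    and "\<And>g t \<omega>. g \<in> \<G> \<Longrightarrow> t < T \<Longrightarrow> \<omega> \<in> space M \<Longrightarrow>
          X g (Suc t) \<omega> = f t (X g t \<omega>) (U g t \<omega>) (W t \<omega>)"
    and "\<And>g t \<omega>. g \<in> \<G> \<Longrightarrow> t < T \<Longrightarrow> \<omega> \<in> space M \<Longrightarrow>
          Xh g (Suc t) \<omega> = fh t (Xh g t \<omega>) (U g t \<omega>) (W t \<omega>)"
    and "\<And>g t \<omega>. g \<in> \<G> \<Longrightarrow> t \<le> T \<Longrightarrow> \<omega> \<in> space M \<Longrightarrow>
          Y g t \<omega> = (\<lambda>k\<in>{1..K}. h t k (X g t \<omega>) (Z t k \<omega>))"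
    and "\<And>g t \<omega>. g \<in> \<G> \<Longrightarrow> t < T \<Longrightarrow> \<omega> \<in> space M \<Longrightarrow>
          U g t \<omega> = g t (model_data K n (Y g) (U g) t \<omega>)"
  shows "(\<forall>t\<le>T. \<exists>\<pi>. \<forall>g\<in>\<G>.
            information_state M K n SY SU \<mu> (X g) (Xh g) (Y g) (U g) t \<pi>) \<and>
         (\<forall>t<T. \<exists>\<phi>. \<forall>g\<in>\<G>. \<forall>p q.
            information_state M K n SY SU \<mu> (X g) (Xh g) (Y g) (U g) t p \<longrightarrow>
            information_state M K n SY SU \<mu> (X g) (Xh g) (Y g) (U g) (Suc t) q \<longrightarrow>
            (AE \<omega> in M. AE x in \<mu> (Suc t).
              q (model_data K n (Y g) (U g) (Suc t) \<omega>) x =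
              \<phi> (p (model_data K n (Y g) (U g) t \<omega>)) (Y g (Suc t) \<omega>) (U g t \<omega>) x))"
proof -
  have sys: "controlled_system M K T n SX SU SW SY SZ f fh h X0 Xh0 W Z \<mu> p_init p_trans p_obs
      g (X g) (Xh g) (Y g) (U g)" if "g \<in> \<G>" for g
    by (intro controlled_system.intro controlled_system_axioms.intro)
      ((rule assms that[unfolded assms(3)]; (rule that | assumption)?)+)
  show ?thesis
  proof (intro conjI allI impI)
    show "\<exists>\<pi>. \<forall>g\<in>\<G>. information_state M K n SY SU \<mu> (X g) (Xh g) (Y g) (U g) t \<pi>" if "t \<le> T" for t
      using that
    proof (induction t)
      case 0
      \<comment> \<open>The closed formula mentions no strategy, so a single witness is a version
        under every \<open>g\<close>.\<close>
      from controlled_system.information_state_0[OF sys] show ?case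
        by (intro exI[of _ "\<lambda>d. bayes_update (\<mu> 0) (\<lambda>v y. \<Prod>k\<in>{1..K}. p_obs 0 k (fst v) (y k))
          p_init (data_Y K n 0 d 0)"] ballI)
    next
      case (Suc t)
      \<comment> \<open>The induction carries one \<open>\<pi>\<close> common to all strategies; the
        filter step turns it into another common version.\<close>
      then obtain \<pi> where \<pi>: "\<forall>g\<in>\<G>. information_state M K n SY SU \<mu> (X g) (Xh g) (Y g) (U g) t \<pi>" by auto
      from Suc.prems have t: "t < T" by simp
      from controlled_system.information_state_Suc[OF sys t \<pi>[rule_format]] show ?case
        by (intro exI[of _ "\<lambda>d. filter_step K \<mu> p_trans p_obs t (\<pi> (prefix_data K n t d))
          (data_Y K n (Suc t) d (Suc t)) (data_U K n (Suc t) d t)"] ballI)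
    qed
    fix t assume t: "t < T"
    show "\<exists>\<phi>. \<forall>g\<in>\<G>. \<forall>p q.
        information_state M K n SY SU \<mu> (X g) (Xh g) (Y g) (U g) t p \<longrightarrow>
        information_state M K n SY SU \<mu> (X g) (Xh g) (Y g) (U g) (Suc t) q \<longrightarrow>
        (AE \<omega> in M. AE x in \<mu> (Suc t).
          q (model_data K n (Y g) (U g) (Suc t) \<omega>) x =
          \<phi> (p (model_data K n (Y g) (U g) t \<omega>)) (Y g (Suc t) \<omega>) (U g t \<omega>) x)"
    \<comment> \<open>\<open>\<phi>\<close> is fixed before \<open>g\<close>, \<open>p\<close> and
      \<open>q\<close> are introduced.\<close>
    proof (intro exI[of _ "filter_step K \<mu> p_trans p_obs t"] ballI allI impI)
      fix g p q assume g: "g \<in> \<G>"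
        and p: "information_state M K n SY SU \<mu> (X g) (Xh g) (Y g) (U g) t p"
        and q: "information_state M K n SY SU \<mu> (X g) (Xh g) (Y g) (U g) (Suc t) q"
      interpret controlled_system M K T n SX SU SW SY SZ f fh h X0 Xh0 W Z \<mu> p_init p_trans p_obs
        g "X g" "Xh g" "Y g" "U g" by (rule sys[OF g])
      \<comment> \<open>\<open>q\<close> is an arbitrary version and the step applied to
        \<open>p\<close> is another, so they agree almost surely; it remains to evaluate the
        truncated data on realized values.\<close>
      from cond_density_AE_unique[OF \<mu> q[unfolded information_state_def]
          information_state_Suc[OF t p, unfolded information_state_def]] t
      have "AE \<omega> in M. AE x in \<mu> (Suc t). q (D (Suc t) \<omega>) x =
          step t (p (prefix_data K n t (D (Suc t) \<omega>))) (data_Y K n (Suc t) (D (Suc t) \<omega>) (Suc t))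
            (data_U K n (Suc t) (D (Suc t) \<omega>) t) x" by simp
      then show "AE \<omega> in M. AE x in \<mu> (Suc t). q (D (Suc t) \<omega>) x = step t (p (D t \<omega>)) (Y g (Suc t) \<omega>) (U g t \<omega>) x"
        using AE_space
      proof eventually_elim
        case (elim \<omega>)
        then show ?case using t by (simp add: prefix_data_D data_Y_D data_U_D)
      qed
    qed
  qed
qed

end
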